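(* In the setting of the context, fix $x_0\in\mathbb R^n$ and let $w^\star=(x^\star,p^\star)\in D(\mathcal A)\times D(\mathcal A^* )$ be the unique solution of the optimality system $\mathcal S(x^\star,p^\star)=(0,(0,x_0))$. Then $w^\star$ is globally uniformly exponentially stable for the primal–dual gradient dynamics $$\dot w(t)=\mathcal Jw(t)-\mathcal R(w(t))-(0,(0,x_0)),\qquad w(0)=w_0,$$ i.e. there exist $M\ge1$ and $\eta_{\mathrm{opt}}>0$ such that for each initial condition $w_0\in\mathcal W$ the unique mild solution $w(\cdot,w_0)$ satisfies $$\|w(t,w_0)-w^\star\|_{\mathcal W}\le Me^{-\eta_{\mathrm{opt}}t}\|w_0-w^\star\|_{\mathcal W},\qquad t\ge0.$$
   Context: Fix $t_f>0$, $n,m\in\mathbb N$. Let $\mathcal X=L^2([0,t_f];\mathbb R^n)$, $\mathcal Y=H^1([0,t_f];\mathbb R^n)$, $\mathcal U=L^2([0,t_f];\mathbb R^m)$, $\mathcal Z=\mathcal X\times\mathbb R^n$, $\mathcal W=\mathcal X\times\mathcal Z$, with the product Hilbert space structures (all spaces real). Let $A\in\mathbb R^{n\times n}$, $B\in\mathbb R^{n\times m}$, $\alpha>0$, $\underline u,\overline u\in\mathbb R^m$ with $\underline u_i<0<\overline u_i$ for all $i$, and $F=\{u\in\mathcal U:\underline u_i\le u_i(t)\le\overline u_i\ \forall i,\text{ a.e. }t\in[0,t_f]\}$. $P_F:\mathcal U\to F$ is the orthogonal projection onto $F$. Let $\ell:\mathbb R^n\to[0,\infty)$ be continuous and convex with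 $\ell(0)=0$, and let $J:\mathcal X\to\mathbb R$, $J(x)=\int_0^{t_f}\ell(x(\tau))\,d\tau$, be Fréchet differentiable with gradient $\nabla J(x)\in\mathcal X$ satisfying, for some $\mu,L>0$, $\mu\|x-y\|_{\mathcal X}^2\le\langle\nabla J(x)-\nabla J(y),x-y\rangle_{\mathcal X}\le L\|x-y\|_{\mathcal X}^2$ for all $x,y\in\mathcal X$. $\mathcal A:\mathcal X\supset D(\mathcal A)=\mathcal Y\to\mathcal Z$, $\mathcal Ax=(\frac{d}{d\tau}x-Ax,\ x(0))$. Its Hilbert space adjoint has domain $D(\mathcal A^* )=\{(\lambda,\lambda_0)\in\mathcal Y\times\mathbb R^n:\lambda(0)=\lambda_0,\ \lambda(t_f)=0\}$ and $\mathcal A^*(\lambda,\lambda_0)=-\frac{d}{d\tau}\lambda-A^\top\lambda$. $\mathcal B:\mathcal U\to\mathcal Z$, $\mathcal Bu=(Bu,0)$, with $\mathcal B^*(\lambda,\lambda_0)=B^\top\lambda$. $\mathcal J:\mathcal W\supset D(\mathcal A)\times D(\mathcal A^* )\to\mathcal W$, $\mathcal J(x,p)=(-\mathcal A^*p,\ \mathcal Ax)$ (skew-adjoint); $\mathcal R:\mathcal W\to\mathcal W$, $\mathcal R(x,p)=(\nabla J(x),\ \mathcal BP_F(\tfrac1\alpha\mathcal B^*p))$; $\mathcal S=\mathcal J-\mathcal R$ on $D(\mathcal A)\times D(\mathcal A^* )$. The optimality system has a unique solution for each $x_0$. A mild solution is a function $w\in C([0,\infty);\mathcal W)$ with $w(t)=T(t)w_0-\int_0^tT(t-s)\bigl[\mathcal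 R(w(s))+(0,(0,x_0))\bigr]ds$ for $t\ge 0$, where $(T(t))$ is the unitary $C_0$-group generated by $\mathcal J$. For each $w_0\in\mathcal W$ it exists and is unique. *)

theory Defs
  imports "HOL-Analysis.Analysis"
begin

section \<open>Square-integrable functions modulo almost-everywhere equality\<close>

definition square_integrable :: "(real \<Rightarrow> 'a::euclidean_space) \<Rightarrow> bool" where
  "square_integrable f \<longleftrightarrow>
     f \<in> borel_measurable lebesgue \<and> integrable lebesgue (\<lambda>t. (norm (f t))\<^sup>2)"

lemma square_integrable_0: "square_integrable (\<lambda>_. 0)"
  by (simp add: square_integrable_def)

lemma square_integrable_scaleR:
  assumes "square_integrable f" shows "square_integrable (\<lambda>t. c *\<^sub>R f t)"
  using assms by (auto simp: square_integrable_def power_mult_distrib)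

lemma square_integrable_add:
  assumes f: "square_integrable f" and g: "square_integrable g"
  shows "square_integrable (\<lambda>t. f t + g t)"
proof -
  have m[measurable]: "f \<in> borel_measurable lebesgue" "g \<in> borel_measurable lebesgue"
    using f g by (auto simp: square_integrable_def)
  have "integrable lebesgue (\<lambda>t. (norm (f t + g t))\<^sup>2)"
  proof (rule Bochner_Integration.integrable_bound)
    show "integrable lebesgue (\<lambda>t. 2 * (norm (f t))\<^sup>2 + 2 * (norm (g t))\<^sup>2)"
      using f g by (auto simp: square_integrable_def)
    have "(norm (f t + g t))\<^sup>2 \<le> 2 * (norm (f t))\<^sup>2 + 2 * (norm (g t))\<^sup>2" for t
    proof -
      have "(norm (f t + g t))\<^sup>2 \<le> (norm (f t) + norm (g t))\<^sup>2"
        by (intro power_mono norm_triangle_ineq norm_ge_zero)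
      also have "\<dots> \<le> 2 * (norm (f t))\<^sup>2 + 2 * (norm (g t))\<^sup>2"
        using sum_squares_bound[of "norm (f t)" "norm (g t)"]
        by (simp add: power2_sum)
      finally show ?thesis .
    qed
    then show "AE t in lebesgue. norm ((norm (f t + g t))\<^sup>2)
                 \<le> norm (2 * (norm (f t))\<^sup>2 + 2 * (norm (g t))\<^sup>2)"
      by simp
  qed measurable
  then show ?thesis by (simp add: square_integrable_def)
qed

lemma square_integrable_minus:
  assumes "square_integrable f" shows "square_integrable (\<lambda>t. - f t)"
  using square_integrable_scaleR[OF assms, of "-1"] by simp

lemma square_integrable_diff:
  assumes "square_integrable f" "square_integrable g"
  shows "square_integrable (\<lambda>t. f t - g t)"
  using square_integrable_add[OF assms(1) square_integrable_minus[OF assms(2)]] by simp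

lemma integrable_inner:
  assumes f: "square_integrable f" and g: "square_integrable g"
  shows "integrable lebesgue (\<lambda>t. f t \<bullet> g t)"
proof -
  have m[measurable]: "f \<in> borel_measurable lebesgue" "g \<in> borel_measurable lebesgue"
    using f g by (auto simp: square_integrable_def)
  show ?thesis
  proof (rule Bochner_Integration.integrable_bound)
    show "integrable lebesgue (\<lambda>t. (norm (f t))\<^sup>2 + (norm (g t))\<^sup>2)"
      using f g by (auto simp: square_integrable_def)
    have "\<bar>f t \<bullet> g t\<bar> \<le> (norm (f t))\<^sup>2 + (norm (g t))\<^sup>2" for t
    proof -
      have "\<bar>f t \<bullet> g t\<bar> \<le> norm (f t) * norm (g t)" by (rule Cauchy_Schwarz_ineq2)
      also have "\<dots> \<le> 2 * norm (f t) * norm (g t)" by simp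
      also have "\<dots> \<le> (norm (f t))\<^sup>2 + (norm (g t))\<^sup>2"
        by (rule sum_squares_bound)
      finally show ?thesis .
    qed
    then show "AE t in lebesgue. norm (f t \<bullet> g t) \<le> norm ((norm (f t))\<^sup>2 + (norm (g t))\<^sup>2)"
      by simp
  qed measurable
qed

lemma square_integrable_bounded_linear:
  fixes T :: "'a::euclidean_space \<Rightarrow> 'b::euclidean_space"
  assumes T: "bounded_linear T" and f: "square_integrable f"
  shows "square_integrable (\<lambda>t. T (f t))"
proof -
  have m[measurable]: "f \<in> borel_measurable lebesgue"
    using f by (auto simp: square_integrable_def)
  have T'[measurable]: "T \<in> borel_measurable borel"
    using T by (intro borel_measurable_continuous_onI linear_continuous_on)
  obtain K where K: "\<And>x. norm (T x) \<le> norm x * K"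
    using T bounded_linear.bounded by blast
  have "integrable lebesgue (\<lambda>t. (norm (T (f t)))\<^sup>2)"
  proof (rule Bochner_Integration.integrable_bound)
    show "integrable lebesgue (\<lambda>t. K\<^sup>2 * (norm (f t))\<^sup>2)"
      using f by (auto simp: square_integrable_def)
    have "(norm (T (f t)))\<^sup>2 \<le> K\<^sup>2 * (norm (f t))\<^sup>2" for t
      using power_mono[OF K[of "f t"] norm_ge_zero, of 2]
      by (simp add: power_mult_distrib mult.commute)
    then show "AE t in lebesgue. norm ((norm (T (f t)))\<^sup>2) \<le> norm (K\<^sup>2 * (norm (f t))\<^sup>2)"
      by simp
  qed measurable
  then show ?thesis by (simp add: square_integrable_def)
qed

quotient_type (overloaded) 'a L2 = "real \<Rightarrow> 'a::euclidean_space" / partial: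
  "\<lambda>f g. square_integrable f \<and> square_integrable g \<and> (AE t in lebesgue. f t = g t)"
proof (rule part_equivpI)
  show "\<exists>f::real \<Rightarrow> 'a. square_integrable f \<and> square_integrable f \<and> (AE t in lebesgue. f t = f t)"
    using square_integrable_0 by auto
  show "symp (\<lambda>f (g::real \<Rightarrow> 'a). square_integrable f \<and> square_integrable g
           \<and> (AE t in lebesgue. f t = g t))"
    by (auto simp: symp_def elim: eventually_mono)
  show "transp (\<lambda>f (g::real \<Rightarrow> 'a). square_integrable f \<and> square_integrable g
           \<and> (AE t in lebesgue. f t = g t))"
    by (auto simp: transp_def elim: eventually_elim2)
qed

instantiation L2 :: (euclidean_space) real_vector
begin

lift_definition zero_L2 :: "'a L2" is "\<lambda>_. 0"
  by (simp add: square_integrable_0)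

lift_definition plus_L2 :: "'a L2 \<Rightarrow> 'a L2 \<Rightarrow> 'a L2" is "\<lambda>f g t. f t + g t"
  by (auto intro: square_integrable_add elim: eventually_elim2)

lift_definition scaleR_L2 :: "real \<Rightarrow> 'a L2 \<Rightarrow> 'a L2" is "\<lambda>c f t. c *\<^sub>R f t"
  by (auto intro: square_integrable_scaleR)

lift_definition uminus_L2 :: "'a L2 \<Rightarrow> 'a L2" is "\<lambda>f t. - f t"
  by (auto intro: square_integrable_minus)

lift_definition minus_L2 :: "'a L2 \<Rightarrow> 'a L2 \<Rightarrow> 'a L2" is "\<lambda>f g t. f t - g t"
  by (auto intro: square_integrable_diff elim: eventually_elim2)

instance
proof
  fix x y z :: "'a L2" and a b :: real
  show "x + y + z = x + (y + z)"
    by transfer (auto intro!: square_integrable_add simp: add.assoc)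
  show "x + y = y + x"
    by transfer (auto intro!: square_integrable_add simp: add.commute)
  show "0 + x = x"
    by transfer auto
  show "- x + x = 0"
    by transfer (simp add: square_integrable_0)
  show "x - y = x + - y"
    by transfer (auto intro!: square_integrable_diff)
  show "a *\<^sub>R (x + y) = a *\<^sub>R x + a *\<^sub>R y"
    by transfer (auto intro!: square_integrable_add square_integrable_scaleR simp: scaleR_add_right)
  show "(a + b) *\<^sub>R x = a *\<^sub>R x + b *\<^sub>R x"
    by transfer (auto intro!: square_integrable_add square_integrable_scaleR simp: scaleR_add_left)
  show "a *\<^sub>R b *\<^sub>R x = (a * b) *\<^sub>R x"
    by transfer (auto intro!: square_integrable_scaleR)
  show "1 *\<^sub>R x = x" by transfer auto
qed

end

instantiation L2 :: (euclidean_space) real_inner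
begin

lift_definition inner_L2 :: "'a L2 \<Rightarrow> 'a L2 \<Rightarrow> real" is "\<lambda>f g. LINT t|lebesgue. f t \<bullet> g t"
proof (elim conjE)
  fix f f' g g' :: "real \<Rightarrow> 'a"
  assume "square_integrable f" "square_integrable f'" "square_integrable g" "square_integrable g'"
  then have [measurable]: "f \<in> borel_measurable lebesgue" "f' \<in> borel_measurable lebesgue"
    "g \<in> borel_measurable lebesgue" "g' \<in> borel_measurable lebesgue"
    by (auto simp: square_integrable_def)
  assume "AE t in lebesgue. f t = f' t" "AE t in lebesgue. g t = g' t"
  then have "AE t in lebesgue. f t \<bullet> g t = f' t \<bullet> g' t" by (auto elim: eventually_elim2)
  then show "(LINT t|lebesgue. f t \<bullet> g t) = (LINT t|lebesgue. f' t \<bullet> g' t)"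
    by (intro integral_cong_AE) auto
qed

definition norm_L2 :: "'a L2 \<Rightarrow> real" where "norm_L2 x = sqrt (x \<bullet> x)"

definition sgn_L2 :: "'a L2 \<Rightarrow> 'a L2" where "sgn_L2 x = x /\<^sub>R norm x"

definition dist_L2 :: "'a L2 \<Rightarrow> 'a L2 \<Rightarrow> real" where "dist_L2 x y = norm (x - y)"

definition uniformity_L2 :: "('a L2 \<times> 'a L2) filter" where
  "uniformity_L2 = (INF e\<in>{0<..}. principal {(x, y). dist x y < e})"

definition open_L2 :: "'a L2 set \<Rightarrow> bool" where
  "open_L2 U \<longleftrightarrow> (\<forall>x\<in>U. eventually (\<lambda>(x', y). x' = x \<longrightarrow> y \<in> U) uniformity)"

instance
proof
  fix x y z :: "'a L2" and r :: real and U :: "'a L2 set"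
  show "dist x y = norm (x - y)" by (rule dist_L2_def)
  show "sgn x = x /\<^sub>R norm x" by (rule sgn_L2_def)
  show "uniformity = (INF e\<in>{0<..}. principal {(x::'a L2, y). dist x y < e})"
    by (rule uniformity_L2_def)
  show "open U \<longleftrightarrow> (\<forall>x\<in>U. eventually (\<lambda>(x', y). x' = x \<longrightarrow> y \<in> U) uniformity)"
    by (rule open_L2_def)
  show "x \<bullet> y = y \<bullet> x" by transfer (simp add: inner_commute)
  show "(x + y) \<bullet> z = x \<bullet> z + y \<bullet> z"
    by transfer (simp add: inner_add_left integrable_inner)
  show "(r *\<^sub>R x) \<bullet> y = r * (x \<bullet> y)" by transfer simp
  show "0 \<le> x \<bullet> x" by transfer (simp add: integral_nonneg)
  show "x \<bullet> x = 0 \<longleftrightarrow> x = 0"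
  proof (transfer, elim conjE)
    fix f :: "real \<Rightarrow> 'a" assume f: "square_integrable f"
    have "(LINT t|lebesgue. f t \<bullet> f t) = 0 \<longleftrightarrow> (AE t in lebesgue. f t \<bullet> f t = 0)"
      by (rule integral_nonneg_eq_0_iff_AE) (use f in \<open>auto intro: integrable_inner\<close>)
    then show "(LINT t|lebesgue. f t \<bullet> f t) = 0 \<longleftrightarrow>
        square_integrable f \<and> square_integrable (\<lambda>_. 0::'a) \<and> (AE t in lebesgue. f t = 0)"
      using f square_integrable_0 by auto
  qed
  show "norm x = sqrt (x \<bullet> x)" by (rule norm_L2_def)
qed

end

text \<open>
  \<open>L2_on S\<close> is the space \<open>L\<^sup>2(S; 'a)\<close>: the classes of functions on the real line that vanish
  almost everywhere outside \<open>S\<close>. Extension by zero identifies it isometrically with the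
  square-integrable functions on \<open>S\<close>. Since the interval is a value and not a type, \<open>L\<^sup>2\<close> of an
  interval, and all operators on it, are relative to this closed subspace of the ambient type.
\<close>

definition L2_on :: "real set \<Rightarrow> 'a::euclidean_space L2 set" where
  "L2_on S = {x. AE t in lebesgue. t \<notin> S \<longrightarrow> rep_L2 x t = 0}"

text \<open>Pointwise multiplication with a constant matrix.\<close>

lift_definition mat_L2 :: "real^'n^'m \<Rightarrow> (real^'n) L2 \<Rightarrow> (real^'m) L2"
  is "\<lambda>A f t. A *v f t"
proof (elim conjE, intro conjI)
  fix A :: "real^'n^'m" and f g :: "real \<Rightarrow> real^'n"
  assume "square_integrable f" "square_integrable g" "AE t in lebesgue. f t = g t"
  then show "square_integrable (\<lambda>t. A *v f t)" "square_integrable (\<lambda>t. A *v g t)"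
    "AE t in lebesgue. A *v f t = A *v g t"
    by (auto intro: square_integrable_bounded_linear[OF matrix_vector_mul_bounded_linear]
        elim: eventually_mono)
qed


section \<open>The Sobolev space H1 on an interval\<close>

text \<open>
  Weak derivatives are tested against continuously differentiable functions with compact support
  in the open interval.
\<close>

definition test_function :: "real \<Rightarrow> (real \<Rightarrow> real) \<Rightarrow> bool" where
  "test_function tf \<phi> \<longleftrightarrow>
     (\<forall>t. \<phi> differentiable at t) \<and> continuous_on UNIV (deriv \<phi>) \<and>
     (\<exists>a b. 0 < a \<and> b < tf \<and> (\<forall>t. t \<notin> {a..b} \<longrightarrow> \<phi> t = 0))"

definition has_weak_deriv :: "real \<Rightarrow> 'a::euclidean_space L2 \<Rightarrow> 'a L2 \<Rightarrow> bool" where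
  "has_weak_deriv tf x y \<longleftrightarrow>
     (\<forall>\<phi>. test_function tf \<phi> \<longrightarrow>
        (LINT t:{0..tf}|lebesgue. deriv \<phi> t *\<^sub>R rep_L2 x t)
          = - (LINT t:{0..tf}|lebesgue. \<phi> t *\<^sub>R rep_L2 y t))"

definition H1 :: "real \<Rightarrow> 'a::euclidean_space L2 set" where
  "H1 tf = {x \<in> L2_on {0..tf}. \<exists>y \<in> L2_on {0..tf}. has_weak_deriv tf x y}"

definition weak_deriv :: "real \<Rightarrow> 'a::euclidean_space L2 \<Rightarrow> 'a L2" where
  "weak_deriv tf x = (THE y. y \<in> L2_on {0..tf} \<and> has_weak_deriv tf x y)"

text \<open>
  Point values of an element of \<open>H1 tf\<close> are those of its continuous representative on
  \<open>{0..tf}\<close>, which is determined by its values there.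
\<close>

definition cont_rep :: "real \<Rightarrow> 'a::euclidean_space L2 \<Rightarrow> real \<Rightarrow> 'a" where
  "cont_rep tf x = (SOME f. continuous_on {0..tf} f \<and>
                      (AE t in lebesgue. t \<in> {0..tf} \<longrightarrow> rep_L2 x t = f t))"


section \<open>Spaces and operators of the optimality system\<close>

text \<open>
  States are of the form \<open>x\<close>, adjoint states of the form \<open>(\<lambda>, \<lambda>\<^sub>0)\<close>. The library's product
  types carry the Hilbert product structure.
\<close>

type_synonym 'n adjst = "(real^'n) L2 \<times> (real^'n)"
type_synonym 'n primal_dual = "(real^'n) L2 \<times> (real^'n) L2 \<times> (real^'n)"

definition Z_space :: "real \<Rightarrow> 'n::finite adjst set" where
  "Z_space tf = L2_on {0..tf} \<times> UNIV"

definition W_space :: "real \<Rightarrow> 'n::finite primal_dual set" where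
  "W_space tf = L2_on {0..tf} \<times> Z_space tf"

definition A_op :: "real \<Rightarrow> real^'n^'n \<Rightarrow> (real^'n) L2 \<Rightarrow> 'n::finite adjst" where
  "A_op tf A x = (weak_deriv tf x - mat_L2 A x, cont_rep tf x 0)"

definition A_adj_dom :: "real \<Rightarrow> 'n::finite adjst set" where
  "A_adj_dom tf = {(l, l0). l \<in> H1 tf \<and> cont_rep tf l 0 = l0 \<and> cont_rep tf l tf = 0}"

definition A_adj :: "real \<Rightarrow> real^'n^'n \<Rightarrow> 'n::finite adjst \<Rightarrow> (real^'n) L2" where
  "A_adj tf A p = - weak_deriv tf (fst p) - mat_L2 (transpose A) (fst p)"

definition B_op :: "real^'m^'n \<Rightarrow> (real^'m) L2 \<Rightarrow> 'n::finite adjst" where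
  "B_op B u = (mat_L2 B u, 0)"

definition B_adj :: "real^'m^'n \<Rightarrow> 'n::finite adjst \<Rightarrow> (real^'m) L2" where
  "B_adj B p = mat_L2 (transpose B) (fst p)"

definition J_dom :: "real \<Rightarrow> 'n::finite primal_dual set" where
  "J_dom tf = H1 tf \<times> A_adj_dom tf"

definition J_op :: "real \<Rightarrow> real^'n^'n \<Rightarrow> 'n::finite primal_dual \<Rightarrow> 'n primal_dual" where
  "J_op tf A w = (- A_adj tf A (snd w), A_op tf A (fst w))"

definition admissible_controls :: "real \<Rightarrow> real^'m \<Rightarrow> real^'m \<Rightarrow> (real^'m) L2 set" where
  "admissible_controls tf ulo uhi =
     {u \<in> L2_on {0..tf}. AE t in lebesgue. t \<in> {0..tf} \<longrightarrow>
        (\<forall>i. ulo $ i \<le> rep_L2 u t $ i \<and> rep_L2 u t $ i \<le> uhi $ i)}"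

text \<open>
  The same definition as \<^const>\<open>closest_point\<close>, whose type class excludes infinite-dimensional
  spaces. On a nonempty closed convex set of a Hilbert space it is the orthogonal projection.
\<close>

definition orth_proj :: "'a::real_inner set \<Rightarrow> 'a \<Rightarrow> 'a" where
  "orth_proj S a = (SOME x. x \<in> S \<and> (\<forall>y\<in>S. dist a x \<le> dist a y))"

definition R_op :: "real \<Rightarrow> real^'m^'n \<Rightarrow> real \<Rightarrow> real^'m \<Rightarrow> real^'m \<Rightarrow>
    ((real^'n) L2 \<Rightarrow> (real^'n) L2) \<Rightarrow> 'n::finite primal_dual \<Rightarrow> 'n primal_dual" where
  "R_op tf B \<alpha> ulo uhi gradJ w =
     (gradJ (fst w),
      B_op B (orth_proj (admissible_controls tf ulo uhi) ((1/\<alpha>) *\<^sub>R B_adj B (snd w))))"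

definition S_op :: "real \<Rightarrow> real^'n^'n \<Rightarrow> real^'m^'n \<Rightarrow> real \<Rightarrow> real^'m \<Rightarrow> real^'m \<Rightarrow>
    ((real^'n) L2 \<Rightarrow> (real^'n) L2) \<Rightarrow> 'n::finite primal_dual \<Rightarrow> 'n primal_dual" where
  "S_op tf A B \<alpha> ulo uhi gradJ w = J_op tf A w - R_op tf B \<alpha> ulo uhi gradJ w"

definition state_cost :: "real \<Rightarrow> (real^'n \<Rightarrow> real) \<Rightarrow> (real^'n) L2 \<Rightarrow> real" where
  "state_cost tf l x = (LINT \<tau>:{0..tf}|lebesgue. l (rep_L2 x \<tau>))"


section \<open>Unitary groups and mild solutions\<close>

definition unitary_C0_group :: "'a::real_inner set \<Rightarrow> (real \<Rightarrow> 'a \<Rightarrow> 'a) \<Rightarrow> bool" where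
  "unitary_C0_group W T \<longleftrightarrow>
     (\<forall>t. \<forall>x\<in>W. T t x \<in> W) \<and>
     (\<forall>t. \<forall>x\<in>W. \<forall>y\<in>W. T t (x + y) = T t x + T t y) \<and>
     (\<forall>t c. \<forall>x\<in>W. T t (c *\<^sub>R x) = c *\<^sub>R T t x) \<and>
     (\<forall>t. \<forall>x\<in>W. \<forall>y\<in>W. T t x \<bullet> T t y = x \<bullet> y) \<and>
     (\<forall>x\<in>W. T 0 x = x) \<and>
     (\<forall>s t. \<forall>x\<in>W. T (s + t) x = T s (T t x)) \<and>
     (\<forall>x\<in>W. continuous_on UNIV (\<lambda>t. T t x))"

definition is_generator ::
    "'a::real_normed_vector set \<Rightarrow> (real \<Rightarrow> 'a \<Rightarrow> 'a) \<Rightarrow> 'a set \<Rightarrow> ('a \<Rightarrow> 'a) \<Rightarrow> bool" where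
  "is_generator W T D G \<longleftrightarrow> D \<subseteq> W \<and>
     (\<forall>x\<in>W. \<forall>y. ((\<lambda>h. (1/h) *\<^sub>R (T h x - x)) \<longlongrightarrow> y) (at 0) \<longleftrightarrow> x \<in> D \<and> G x = y)"

text \<open>
  Mild solutions of \<open>w' = J w - f(w)\<close> with \<open>w(0) = w0\<close> for the group \<open>T\<close> generated by \<open>J\<close>. The
  integrand is continuous for continuous \<open>f\<close>, so the gauge integral of the library is the
  Riemann integral.
\<close>

definition mild_solution ::
    "'a::real_normed_vector set \<Rightarrow> (real \<Rightarrow> 'a \<Rightarrow> 'a) \<Rightarrow> ('a \<Rightarrow> 'a) \<Rightarrow> 'a \<Rightarrow> (real \<Rightarrow> 'a) \<Rightarrow> bool" where
  "mild_solution W T f w0 w \<longleftrightarrow>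
     continuous_on {0..} w \<and> (\<forall>t\<ge>0. w t \<in> W) \<and>
     (\<forall>t\<ge>0. (\<lambda>s. T (t - s) (f (w s))) integrable_on {0..t} \<and>
             w t = T t w0 - integral {0..t} (\<lambda>s. T (t - s) (f (w s))))"

end

theory Submission
  imports Defs
begin

text \<open>
  Let \<open>v = (x, p)\<close> be the deviation of a mild solution from the equilibrium. Since the group is
  unitary, only the monotone operator \<open>R\<close> dissipates \<open>\<parallel>v\<parallel>\<^sup>2\<close>, and it controls \<open>x\<close> but not \<open>p\<close>. Damping
  of \<open>p\<close> comes from the coupling: if \<open>G\<close> is the inverse of the state operator, the derivative of
  \<open>x \<bullet> G p\<close> contains \<open>- \<parallel>p\<parallel>\<^sup>2\<close>, all other terms being bounded by \<open>\<parallel>x\<parallel>\<^sup>2\<close> and \<open>\<parallel>x\<parallel> \<parallel>p\<parallel>\<close>. Hence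
  \<open>\<parallel>v\<parallel>\<^sup>2 + 2 \<epsilon> x \<bullet> G p\<close> is a strict Lyapunov function for small \<open>\<epsilon>\<close>. The product \<open>x \<bullet> G p\<close> is
  differentiable although \<open>x\<close> and \<open>p\<close> are not, because \<open>(G p, 0)\<close> lies in the domain of the generator.
  The state and adjoint operators are inverted by solving Volterra equations; no integration by parts
  between them is needed, as skew-symmetry of \<open>J\<close> follows from unitarity of the group.
\<close>

section \<open>Mild solutions for unitary groups\<close>

text \<open>The abstract part lives in \<open>real_inner\<close> spaces without completeness and
  relative to a subspace. The integral in the mild solution formula is therefore tested against
  fixed vectors, and strong derivatives are recovered from weak ones. The sign behind the coupling:
  formally \<open>x' = - A_adj p - a\<close> and \<open>p' = A_op x - b\<close>, where
  \<open>a\<close>, \<open>b\<close> are the increments of the monotone terms. So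
  \<open>x' \<bullet> G p\<close> contributes \<open>- p \<bullet> p\<close>, while
  \<open>x \<bullet> (G p)'\<close> contributes \<open>x \<bullet> x\<close>, which strong
  monotonicity with constant \<mu> absorbs. On a finite horizon \<open>G\<close> is bounded for
  every matrix: \<open>G (f, c)\<close> solves \<open>x' = A x + f\<close>, \<open>x(0) = c\<close>.
  The estimates use a Lipschitz bound on \<open>gradJ\<close>, while only one-sided bounds are
  given; it is recovered from \<open>gradJ\<close> being the gradient of a potential. Membership in
  \<open>H1\<close> is only ever established for explicit indefinite integrals; uniqueness of weak
  derivatives and of continuous representatives then evaluates the operators on them.\<close>

lemma has_vector_derivative_iff_tendsto:
  "(f has_vector_derivative d) (at x within S) \<longleftrightarrow>
     ((\<lambda>y. (f y - f x) /\<^sub>R (y - x)) \<longlongrightarrow> d) (at x within S)"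
proof -
  have "norm ((1 / norm (y - x)) *\<^sub>R (f y - (f x + (y - x) *\<^sub>R d))) =
      norm ((f y - f x) /\<^sub>R (y - x) - d)" if "y \<noteq> x" for y
  proof -
    have "(f y - f x) /\<^sub>R (y - x) - d = (f y - (f x + (y - x) *\<^sub>R d)) /\<^sub>R (y - x)"
      using that by (simp add: scaleR_diff_right scaleR_add_right)
    then show ?thesis by (simp add: divide_inverse)
  qed
  then have "((\<lambda>y. norm ((1 / norm (y - x)) *\<^sub>R (f y - (f x + (y - x) *\<^sub>R d)))) \<longlongrightarrow> 0) (at x within S)
     \<longleftrightarrow> ((\<lambda>y. norm ((f y - f x) /\<^sub>R (y - x) - d)) \<longlongrightarrow> 0) (at x within S)"
    by (intro Lim_cong_within) auto
  then have "((\<lambda>y. (1 / norm (y - x)) *\<^sub>R (f y - (f x + (y - x) *\<^sub>R d))) \<longlongrightarrow> 0) (at x within S)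
     \<longleftrightarrow> ((\<lambda>y. (f y - f x) /\<^sub>R (y - x)) \<longlongrightarrow> d) (at x within S)"
    by (simp only: tendsto_norm_zero_iff LIM_zero_iff)
  then show ?thesis
    unfolding has_vector_derivative_def has_derivative_within
    by (simp add: bounded_linear_scaleR_left)
qed

text \<open>The remainder \<open>D\<close> of the first-order expansion is itself an admissible test
  vector. The scalar mean value inequality tested with \<open>D\<close> gives
  \<open>norm D * norm D \<le> e * norm D * norm (s - t)\<close>, because continuity of
  \<open>r\<close> bounds \<open>r q - r t\<close> uniformly in all directions.\<close>

lemma has_vector_derivative_weak_imp_strong:
  fixes u r :: "real \<Rightarrow> 'a::real_inner"
  assumes S: "subspace S" and u: "\<And>t. t \<ge> 0 \<Longrightarrow> u t \<in> S" and r: "\<And>t. t \<ge> 0 \<Longrightarrow> r t \<in> S"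
    and cont: "continuous_on {0..} r"
    and weak: "\<And>y t. y \<in> S \<Longrightarrow> t \<ge> 0 \<Longrightarrow>
      ((\<lambda>t. u t \<bullet> y) has_real_derivative r t \<bullet> y) (at t within {0..})"
    and t: "t \<ge> 0"
  shows "(u has_vector_derivative r t) (at t within {0..})"
  unfolding has_vector_derivative_def has_derivative_within_alt
proof (intro conjI allI impI)
  show "bounded_linear (\<lambda>x. x *\<^sub>R r t)" by (rule bounded_linear_scaleR_left)
  fix e :: real assume e: "e > 0"
  obtain d where d: "d > 0" "\<And>s. s \<ge> 0 \<Longrightarrow> dist s t < d \<Longrightarrow> dist (r s) (r t) < e"
    using cont t e unfolding continuous_on_iff by (metis atLeast_iff)
  have "norm (u s - u t - (s - t) *\<^sub>R r t) \<le> e * norm (s - t)" if s: "s \<ge> 0" "norm (s - t) < d" for s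
  proof -
    define D where "D = u s - u t - (s - t) *\<^sub>R r t"
    have D: "D \<in> S" unfolding D_def using S s t u r
      by (intro subspace_diff subspace_scale) auto
    let ?I = "{0..} \<inter> ball t d"
    have "norm ((u s - s *\<^sub>R r t) \<bullet> D - (u t - t *\<^sub>R r t) \<bullet> D) \<le> (e * norm D) * norm (s - t)"
    proof (rule field_differentiable_bound[where S = ?I and f' = "\<lambda>q. (r q - r t) \<bullet> D"])
      show "convex ?I" by (intro convex_Int convex_ball) auto
      fix q assume q: "q \<in> ?I"
      have "((\<lambda>q. u q \<bullet> D - q * (r t \<bullet> D)) has_real_derivative r q \<bullet> D - r t \<bullet> D) (at q within {0..})"
        using weak[OF D] q by (auto intro!: derivative_eq_intros)
      then show "((\<lambda>q. (u q - q *\<^sub>R r t) \<bullet> D) has_real_derivative (r q - r t) \<bullet> D) (at q within ?I)"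
        by (auto simp: inner_diff_left intro: DERIV_subset)
      have "norm (r q - r t) \<le> e" using d(2)[of q] q by (auto simp: dist_norm abs_minus_commute less_imp_le)
      then show "norm ((r q - r t) \<bullet> D) \<le> e * norm D"
        using order_trans[OF Cauchy_Schwarz_ineq2[of "r q - r t" D] mult_right_mono[of _ e "norm D"]] by simp
    qed (use s t d in \<open>auto simp: dist_norm norm_minus_commute\<close>)
    moreover have "(u s - s *\<^sub>R r t) \<bullet> D - (u t - t *\<^sub>R r t) \<bullet> D = norm D * norm D"
    proof -
      have "(u s - s *\<^sub>R r t) - (u t - t *\<^sub>R r t) = D"
        unfolding D_def by (simp add: algebra_simps)
      then show ?thesis by (metis inner_diff_left dot_square_norm power2_eq_square)
    qed
    ultimately have "norm D * norm D \<le> norm D * (e * norm (s - t))" by (simp add: algebra_simps)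
    then show ?thesis using e unfolding D_def[symmetric]
      by (cases "norm D = 0") (auto simp: mult_le_cancel_left)
  qed
  with d(1) show "\<exists>d>0. \<forall>s\<in>{0..}. norm (s - t) < d \<longrightarrow>
      norm (u s - u t - (s - t) *\<^sub>R r t) \<le> e * norm (s - t)" by auto
qed

text \<open>A product rule in which \<open>x\<close> is only continuous. In the split
  \<open>x s \<bullet> (u s - u t) + (x s - x t) \<bullet> u t\<close> the increment of
  \<open>x\<close> meets only the fixed vector \<open>u t\<close>.\<close>

lemma has_real_derivative_inner_continuous:
  fixes x u :: "real \<Rightarrow> 'a::real_inner"
  assumes x: "continuous (at t within S) x"
    and u: "(u has_vector_derivative u') (at t within S)"
    and c: "((\<lambda>s. x s \<bullet> u t) has_real_derivative c) (at t within S)"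
  shows "((\<lambda>s. x s \<bullet> u s) has_real_derivative x t \<bullet> u' + c) (at t within S)"
proof -
  have "((\<lambda>s. x s \<bullet> ((u s - u t) /\<^sub>R (s - t)) + (x s \<bullet> u t - x t \<bullet> u t) / (s - t))
      \<longlongrightarrow> x t \<bullet> u' + c) (at t within S)"
    using x u c unfolding has_vector_derivative_iff_tendsto has_field_derivative_iff continuous_within
    by (intro tendsto_add tendsto_inner)
  then show ?thesis unfolding has_field_derivative_iff
    by (rule Lim_transform_within[where d = 1]) (auto simp: inner_diff_right divide_inverse algebra_simps)
qed

text \<open>Gronwall in differential form: \<open>exp (k * t) * V t\<close> is nonincreasing.
  Interior points suffice, and there the one-sided derivative is two-sided.\<close>

lemma exponential_decay_if_deriv_le:
  fixes V :: "real \<Rightarrow> real"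
  assumes V: "\<And>t. t \<ge> 0 \<Longrightarrow> \<exists>D. (V has_real_derivative D) (at t within {0..}) \<and> D \<le> - k * V t"
    and t: "t \<ge> 0"
  shows "V t \<le> exp (- k * t) * V 0"
proof -
  obtain D where D: "\<And>t. t \<ge> 0 \<Longrightarrow> (V has_real_derivative D t) (at t within {0..})"
    "\<And>t. t \<ge> 0 \<Longrightarrow> D t \<le> - k * V t" using V by metis
  have "exp (k * t) * V t \<le> exp (k * 0) * V 0"
  proof (rule DERIV_nonpos_imp_decreasing_open[OF t])
    fix s assume s: "0 < s" "s < t"
    have "at s within {0..} = at s"
      using s by (intro at_within_nhd[of s "{0<..}"]) auto
    then have "((\<lambda>s. exp (k * s) * V s) has_real_derivative exp (k * s) * (k * V s + D s)) (at s)"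
      using D(1)[of s] s by (auto intro!: derivative_eq_intros simp: algebra_simps)
    moreover have "exp (k * s) * (k * V s + D s) \<le> 0"
      using D(2)[of s] s by (intro mult_nonneg_nonpos) auto
    ultimately show "\<exists>y. ((\<lambda>s. exp (k * s) * V s) has_real_derivative y) (at s) \<and> y \<le> 0" by blast
  next
    have "continuous_on {0..} V" using D(1) by (auto intro!: DERIV_continuous_on)
    then show "continuous_on {0..t} (\<lambda>s. exp (k * s) * V s)"
      by (intro continuous_intros) (auto elim: continuous_on_subset)
  qed
  then show ?thesis by (simp add: exp_minus field_simps)
qed

section \<open>Unitary groups on a subspace: skew-symmetry of the generator and derivatives along
  mild solutions\<close>

locale unitary_group =
  fixes W :: "'a::real_inner set" and T :: "real \<Rightarrow> 'a \<Rightarrow> 'a" and D :: "'a set" and J :: "'a \<Rightarrow> 'a"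
  assumes W: "subspace W" and grp: "unitary_C0_group W T" and gen: "is_generator W T D J"
begin

lemma T_in: "x \<in> W \<Longrightarrow> T t x \<in> W"
  and T_add: "x \<in> W \<Longrightarrow> y \<in> W \<Longrightarrow> T t (x + y) = T t x + T t y"
  and T_scale: "x \<in> W \<Longrightarrow> T t (c *\<^sub>R x) = c *\<^sub>R T t x"
  and T_inner: "x \<in> W \<Longrightarrow> y \<in> W \<Longrightarrow> T t x \<bullet> T t y = x \<bullet> y"
  and T_0: "x \<in> W \<Longrightarrow> T 0 x = x"
  and T_plus: "x \<in> W \<Longrightarrow> T (s + t) x = T s (T t x)"
  and T_cont: "x \<in> W \<Longrightarrow> continuous_on UNIV (\<lambda>t. T t x)"
  using grp unfolding unitary_C0_group_def by blast+

lemma D_W: "x \<in> D \<Longrightarrow> x \<in> W"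
  using gen unfolding is_generator_def by blast

lemma gen_lim: "x \<in> D \<Longrightarrow> ((\<lambda>h. (1/h) *\<^sub>R (T h x - x)) \<longlongrightarrow> J x) (at 0)"
  using gen D_W unfolding is_generator_def by blast

lemma T_diff: "x \<in> W \<Longrightarrow> y \<in> W \<Longrightarrow> T t (x - y) = T t x - T t y"
  using T_add[of x "- y" t] T_scale[of y t "-1"] W by (simp add: subspace_neg)

lemma norm_T: "x \<in> W \<Longrightarrow> norm (T t x) = norm x"
  by (simp add: norm_eq_sqrt_inner T_inner)

lemma T_minus: "x \<in> W \<Longrightarrow> T (- t) (T t x) = x" "x \<in> W \<Longrightarrow> T t (T (- t) x) = x"
  using T_plus[of x "-t" t] T_plus[of x t "-t"] T_0 by simp_all

lemma T_adjoint: "x \<in> W \<Longrightarrow> y \<in> W \<Longrightarrow> T (- t) x \<bullet> y = x \<bullet> T t y"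
  using T_inner[of "T (-t) x" y t] T_in T_minus by simp

text \<open>The adjoint of \<open>T h\<close> is \<open>T (- h)\<close>, so the difference quotient
  at \<open>h\<close> tested with \<open>y\<close> is minus the quotient of \<open>y\<close> at
  \<open>- h\<close> tested with \<open>x\<close>. The limit defining the generator is two-sided,
  hence both converge.\<close>

lemma J_skew:
  assumes x: "x \<in> D" and y: "y \<in> D"
  shows "J x \<bullet> y = - (x \<bullet> J y)"
proof -
  have 1: "((\<lambda>h. (1/h) *\<^sub>R (T h x - x) \<bullet> y) \<longlongrightarrow> J x \<bullet> y) (at 0)"
    using gen_lim[OF x] by (intro tendsto_intros)
  have "((\<lambda>h. x \<bullet> (1/(-h)) *\<^sub>R (T (-h) y - y)) \<longlongrightarrow> x \<bullet> J y) (at 0)"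
    using filterlim_compose[OF gen_lim[OF y], of uminus "at 0"]
    by (intro tendsto_intros) (auto simp: filterlim_def filtermap_at_minus)
  then have 2: "((\<lambda>h. - (x \<bullet> (1/(-h)) *\<^sub>R (T (-h) y - y))) \<longlongrightarrow> - (x \<bullet> J y)) (at 0)"
    by (rule tendsto_minus)
  have "- (x \<bullet> (1/(-h)) *\<^sub>R (T (-h) y - y)) = (1/h) *\<^sub>R (T h x - x) \<bullet> y" for h
    using T_adjoint[of y x h] D_W x y
    by (simp add: inner_diff_left inner_diff_right inner_commute algebra_simps)
  then have "((\<lambda>h. (1/h) *\<^sub>R (T h x - x) \<bullet> y) \<longlongrightarrow> - (x \<bullet> J y)) (at 0)"
    using 2 by (simp only:)
  from tendsto_unique[OF _ 1 this] show ?thesis by simp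
qed

text \<open>The isometry \<open>T t\<close> factors out of the quotient, so the error at
  \<open>t\<close> has the same norm as the error at 0.\<close>

lemma T_has_vector_derivative:
  assumes y: "y \<in> D" "J y \<in> W"
  shows "((\<lambda>t. T t y) has_vector_derivative T t (J y)) (at t within S)"
proof -
  have "((\<lambda>s. (T s y - T t y) /\<^sub>R (s - t)) \<longlongrightarrow> T t (J y)) (at t)"
  proof (rule LIM_zero_cancel, rule tendsto_norm_zero_cancel)
    have "norm ((T s y - T t y) /\<^sub>R (s - t) - T t (J y)) =
        norm ((1/(s - t)) *\<^sub>R (T (s - t) y - y) - J y)" for s
    proof -
      have "T s y = T t (T (s - t) y)" using T_plus[of y t "s - t"] y D_W by simp
      then have "(T s y - T t y) /\<^sub>R (s - t) - T t (J y) =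
          T t ((1/(s - t)) *\<^sub>R (T (s - t) y - y) - J y)"
        using y D_W T_in W
        by (simp add: T_diff T_scale subspace_diff subspace_scale inverse_eq_divide)
      then show ?thesis
        using y D_W T_in W by (simp add: norm_T subspace_diff subspace_scale)
    qed
    moreover have "((\<lambda>h. norm ((1/h) *\<^sub>R (T h y - y) - J y)) \<longlongrightarrow> 0) (at 0)"
      using gen_lim[OF y(1)] by (intro tendsto_norm_zero LIM_zero)
    ultimately show "((\<lambda>s. norm ((T s y - T t y) /\<^sub>R (s - t) - T t (J y))) \<longlongrightarrow> 0) (at t)"
      by (simp add: LIM_offset_zero_iff[where a = t])
  qed
  then show ?thesis
    unfolding has_vector_derivative_iff_tendsto by (rule tendsto_within_subset) simp
qed

lemma T_uminus_has_vector_derivative: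
  assumes y: "y \<in> D" "J y \<in> W"
  shows "((\<lambda>t. T (- t) y) has_vector_derivative - T (- t) (J y)) (at t within S)"
proof -
  have "(uminus has_vector_derivative (-1::real)) (at t within S)"
    unfolding has_real_derivative_iff_has_vector_derivative[symmetric]
    by (intro derivative_eq_intros) auto
  from vector_diff_chain_within[OF this T_has_vector_derivative[OF y]] show ?thesis
    by (simp add: o_def)
qed

text \<open>Testing with \<open>T t y\<close> turns \<open>T (t - s)\<close> under the integral into
  \<open>T s y\<close> on the other side, and the integral becomes a scalar one. The constant
  function \<open>ws\<close> satisfies the same identity; the difference of the two is the
  claim.\<close>

lemma mild_solution_weak:
  assumes ws: "ws \<in> D" "J ws = F ws" and FW: "F ` W \<subseteq> W"
    and F_cont: "continuous_on W F" and w0: "w0 \<in> W" and w: "mild_solution W T F w0 w"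
    and y: "y \<in> W" and t: "t \<ge> 0"
  shows "T (- t) (w t - ws) \<bullet> y = (w0 - ws) \<bullet> y - integral {0..t} (\<lambda>s. (F (w s) - F ws) \<bullet> T s y)"
proof -
  have F: "\<And>x. x \<in> W \<Longrightarrow> F x \<in> W" using FW by auto
  have wW: "\<And>s. s \<ge> 0 \<Longrightarrow> w s \<in> W" and wc: "continuous_on {0..} w"
    and int: "(\<lambda>s. T (t - s) (F (w s))) integrable_on {0..t}"
    and eq: "w t = T t w0 - integral {0..t} (\<lambda>s. T (t - s) (F (w s)))"
    using w t unfolding mild_solution_def by auto
  have wsW: "ws \<in> W" using ws D_W by simp
  have Fwc: "continuous_on {0..t} (\<lambda>s. F (w s))"
    using wW by (intro continuous_on_compose2[OF F_cont] continuous_on_subset[OF wc]) auto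
  have Tc: "continuous_on {0..t} (\<lambda>s. T s y)"
    using T_cont[OF y] continuous_on_subset by blast
  have "integral {0..t} (\<lambda>s. T (t - s) (F (w s))) \<bullet> T t y
      = integral {0..t} (\<lambda>s. T (t - s) (F (w s)) \<bullet> T t y)"
    using integral_linear[OF int bounded_linear_inner_left[of "T t y"]] by (simp add: o_def)
  also have "\<dots> = integral {0..t} (\<lambda>s. F (w s) \<bullet> T s y)"
  proof (rule integral_cong)
    fix s assume "s \<in> {0..t}"
    then show "T (t - s) (F (w s)) \<bullet> T t y = F (w s) \<bullet> T s y"
      using T_plus[OF y, of "t - s" s] T_inner[OF F[OF wW] T_in[OF y]] by simp
  qed
  finally have 1: "w t \<bullet> T t y = w0 \<bullet> y - integral {0..t} (\<lambda>s. F (w s) \<bullet> T s y)"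
    unfolding eq by (simp add: inner_diff_left T_inner w0 y)
  \<comment> \<open>Since \<open>J ws = F ws\<close>, the orbit \<open>T (- s) ws\<close> has
    derivative \<open>- T (- s) (F ws)\<close>, which provides an antiderivative of the
    integrand.\<close>
  have "((\<lambda>s. F ws \<bullet> T s y) has_integral (- (T (- t) ws \<bullet> y) - - (T (- 0) ws \<bullet> y))) {0..t}"
  proof (rule fundamental_theorem_of_calculus[OF t])
    fix s
    have "((\<lambda>s. - (T (- s) ws \<bullet> y)) has_vector_derivative - (- T (- s) (F ws) \<bullet> y)) (at s within {0..t})"
      using ws F[OF wsW]
      by (intro T_uminus_has_vector_derivative[of ws, unfolded ws(2)] has_vector_derivative_minus bounded_linear.has_vector_derivative[OF bounded_linear_inner_left])
    then show "((\<lambda>s. - (T (- s) ws \<bullet> y)) has_vector_derivative F ws \<bullet> T s y) (at s within {0..t})"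
      using T_adjoint[OF F[OF wsW] y] by simp
  qed
  then have 2: "integral {0..t} (\<lambda>s. F ws \<bullet> T s y) = ws \<bullet> y - T (- t) ws \<bullet> y"
    by (simp add: integral_unique T_0 wsW)
  have "T (- t) (w t - ws) \<bullet> y = w t \<bullet> T t y - T (- t) ws \<bullet> y"
    using T_adjoint[OF wW[OF t] y] by (simp add: T_diff wW t wsW inner_diff_left)
  also have "\<dots> = (w0 - ws) \<bullet> y - (integral {0..t} (\<lambda>s. F (w s) \<bullet> T s y) - integral {0..t} (\<lambda>s. F ws \<bullet> T s y))"
    unfolding 1 2 by (simp add: inner_diff_left)
  also have "integral {0..t} (\<lambda>s. F (w s) \<bullet> T s y) - integral {0..t} (\<lambda>s. F ws \<bullet> T s y)
      = integral {0..t} (\<lambda>s. (F (w s) - F ws) \<bullet> T s y)"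
    unfolding inner_diff_left
    by (intro integral_diff[symmetric] integrable_continuous_interval continuous_intros Fwc Tc)
  finally show ?thesis .
qed

text \<open>The mild solution itself need not be differentiable, but it becomes so after it is
  transported back along the group.\<close>

lemma mild_solution_has_vector_derivative:
  assumes ws: "ws \<in> D" "J ws = F ws" and FW: "F ` W \<subseteq> W"
    and F_cont: "continuous_on W F" and w0: "w0 \<in> W" and w: "mild_solution W T F w0 w"
    and t: "t \<ge> 0"
  shows "((\<lambda>t. T (- t) (w t - ws)) has_vector_derivative - T (- t) (F (w t) - F ws)) (at t within {0..})"
proof (rule has_vector_derivative_weak_imp_strong[OF W _ _ _ _ t])
  have F: "\<And>x. x \<in> W \<Longrightarrow> F x \<in> W" using FW by auto
  have wW: "\<And>s. s \<ge> 0 \<Longrightarrow> w s \<in> W" and wc: "continuous_on {0..} w"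
    using w t unfolding mild_solution_def by auto
  have wsW: "ws \<in> W" using ws D_W by simp
  have gW: "F (w s) - F ws \<in> W" if "s \<ge> 0" for s using that wsW wW F W by (simp add: subspace_diff)
  have gc: "continuous_on {0..} (\<lambda>s. F (w s) - F ws)"
    using wW by (intro continuous_intros continuous_on_compose2[OF F_cont] wc) auto
  show "T (- s) (w s - ws) \<in> W" "- T (- s) (F (w s) - F ws) \<in> W" if "s \<ge> 0" for s
    using that wsW wW W by (auto intro!: subspace_neg T_in gW subspace_diff)
  \<comment> \<open>Strong continuity of the group covers a fixed vector only; the change of the
    vector itself is controlled by the isometry.\<close>
  have "((\<lambda>q. T (- q) (F (w q) - F ws)) \<longlongrightarrow> T (- s) (F (w s) - F ws)) (at s within {0..})"
    if s: "s \<ge> 0" for s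
  proof (rule LIM_zero_cancel, rule Lim_null_comparison)
    let ?g = "\<lambda>s. F (w s) - F ws"
    show "\<forall>\<^sub>F q in at s within {0..}. norm (T (- q) (?g q) - T (- s) (?g s))
        \<le> norm (?g q - ?g s) + norm (T (- q) (?g s) - T (- s) (?g s))"
      unfolding eventually_at_filter
    proof (intro always_eventually allI impI)
      fix q assume "q \<noteq> s" "q \<in> {0..}"
      then have q: "?g q \<in> W" "?g s \<in> W" using gW s by auto
      have "norm (T (- q) (?g q) - T (- s) (?g s))
         \<le> norm (T (- q) (?g q) - T (- q) (?g s)) + norm (T (- q) (?g s) - T (- s) (?g s))"
        by (rule norm_diff_triangle_le[OF order_refl order_refl])
      also have "T (- q) (?g q) - T (- q) (?g s) = T (- q) (?g q - ?g s)"
        using q by (rule T_diff[symmetric])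
      also have "norm \<dots> = norm (?g q - ?g s)" by (intro norm_T subspace_diff[OF W q])
      finally show "norm (T (- q) (?g q) - T (- s) (?g s))
        \<le> norm (?g q - ?g s) + norm (T (- q) (?g s) - T (- s) (?g s))" .
    qed
    have "continuous_on UNIV (\<lambda>q. T (- q) (?g s))"
      by (rule continuous_on_compose2[OF T_cont[OF gW[OF s]] continuous_on_minus[OF continuous_on_id]]) simp
    then have "((\<lambda>q. T (- q) (?g s)) \<longlongrightarrow> T (- s) (?g s)) (at s within {0..})"
      by (meson UNIV_I continuous_on_def subset_UNIV tendsto_within_subset)
    moreover have "(?g \<longlongrightarrow> ?g s) (at s within {0..})"
      using gc s unfolding continuous_on_def by auto
    ultimately show "((\<lambda>q. norm (?g q - ?g s) + norm (T (- q) (?g s) - T (- s) (?g s))) \<longlongrightarrow> 0)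
        (at s within {0..})"
      by (intro tendsto_add_zero tendsto_norm_zero LIM_zero)
  qed
  then show "continuous_on {0..} (\<lambda>s. - T (- s) (F (w s) - F ws))"
    unfolding continuous_on_def by (auto intro!: tendsto_intros)
  fix y s assume y: "y \<in> W" and s: "(s::real) \<ge> 0"
  have c: "continuous_on {0..} (\<lambda>s. (F (w s) - F ws) \<bullet> T s y)"
    using T_cont[OF y] by (intro continuous_intros gc) (auto intro: continuous_on_subset)
  \<comment> \<open>The fundamental theorem is applied on the compact interval
    \<open>{0..s+1}\<close>, which coincides with the half line near \<open>s\<close>, including at
    \<open>s = 0\<close>.\<close>
  have "((\<lambda>s. (w0 - ws) \<bullet> y - integral {0..s} (\<lambda>s. (F (w s) - F ws) \<bullet> T s y)) has_real_derivative
      0 - (F (w s) - F ws) \<bullet> T s y) (at s within {0..s+1})"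
    using s continuous_on_subset[OF c]
    by (intro DERIV_diff DERIV_const integral_has_real_derivative) auto
  then have "((\<lambda>s. T (- s) (w s - ws) \<bullet> y) has_real_derivative
      0 - (F (w s) - F ws) \<bullet> T s y) (at s within {0..s+1})"
    by (rule has_field_derivative_transform_within[where d = 1])
      (use s mild_solution_weak[OF ws FW F_cont w0 w y] in auto)
  also have "0 - (F (w s) - F ws) \<bullet> T s y = - T (- s) (F (w s) - F ws) \<bullet> y"
    using T_adjoint[OF gW[OF s] y] by simp
  also have "at s within {0..s+1} = at s within {0..}"
    using s by (intro at_within_nhd[of s "{..<s+1}"]) auto
  finally show "((\<lambda>s. T (- s) (w s - ws) \<bullet> y) has_real_derivative
    - T (- s) (F (w s) - F ws) \<bullet> y) (at s within {0..})" .
qed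

text \<open>Applying \<open>T (- t)\<close> to both factors leaves the inner product unchanged and
  makes both differentiable: the deviation by the preceding lemma, \<open>y\<close> because it lies
  in the domain.\<close>

lemma mild_solution_inner_has_derivative:
  assumes ws: "ws \<in> D" "J ws = F ws" and FW: "F ` W \<subseteq> W"
    and F_cont: "continuous_on W F" and w0: "w0 \<in> W" and w: "mild_solution W T F w0 w"
    and t: "t \<ge> 0" and y: "y \<in> D" "J y \<in> W"
  shows "((\<lambda>t. (w t - ws) \<bullet> y) has_real_derivative
    - ((w t - ws) \<bullet> J y) - (F (w t) - F ws) \<bullet> y) (at t within {0..})"
proof -
  have F: "\<And>x. x \<in> W \<Longrightarrow> F x \<in> W" using FW by auto
  have wW: "\<And>s. s \<ge> 0 \<Longrightarrow> w s \<in> W" using w t unfolding mild_solution_def by auto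
  have W': "ws \<in> W" "y \<in> W" using ws y D_W by auto
  have gW: "F (w t) - F ws \<in> W" using t W' wW F W by (simp add: subspace_diff)
  have vW: "w s - ws \<in> W" if "s \<ge> 0" for s using that W' wW W by (simp add: subspace_diff)
  have "((\<lambda>s. T (- s) (w s - ws) \<bullet> T (- s) y) has_vector_derivative
      T (- t) (w t - ws) \<bullet> - T (- t) (J y) + - T (- t) (F (w t) - F ws) \<bullet> T (- t) y) (at t within {0..})"
    by (rule bounded_bilinear.has_vector_derivative[OF bounded_bilinear_inner
          mild_solution_has_vector_derivative[OF ws FW F_cont w0 w t]
          T_uminus_has_vector_derivative[OF y]])
  then have "((\<lambda>s. T (- s) (w s - ws) \<bullet> T (- s) y) has_real_derivative
      - ((w t - ws) \<bullet> J y) - (F (w t) - F ws) \<bullet> y) (at t within {0..})"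
    using vW[OF t] gW y W' by (simp add: T_inner has_real_derivative_iff_has_vector_derivative)
  then show ?thesis
    by (rule has_field_derivative_transform_within[where d = 1]) (use t vW W' in \<open>auto simp: T_inner\<close>)
qed

text \<open>The energy identity: the norm of the deviation equals that of its transported version,
  whose derivative contains no generator term.\<close>

lemma mild_solution_norm_has_derivative:
  assumes ws: "ws \<in> D" "J ws = F ws" and FW: "F ` W \<subseteq> W"
    and F_cont: "continuous_on W F" and w0: "w0 \<in> W" and w: "mild_solution W T F w0 w"
    and t: "t \<ge> 0"
  shows "((\<lambda>t. (w t - ws) \<bullet> (w t - ws)) has_real_derivative
    - 2 * ((w t - ws) \<bullet> (F (w t) - F ws))) (at t within {0..})"
proof -
  have F: "\<And>x. x \<in> W \<Longrightarrow> F x \<in> W" using FW by auto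
  have wW: "\<And>s. s \<ge> 0 \<Longrightarrow> w s \<in> W" using w t unfolding mild_solution_def by auto
  have W': "ws \<in> W" using ws D_W by auto
  have gW: "F (w t) - F ws \<in> W" using t W' wW F W by (simp add: subspace_diff)
  have vW: "w s - ws \<in> W" if "s \<ge> 0" for s using that W' wW W by (simp add: subspace_diff)
  note z = mild_solution_has_vector_derivative[OF ws FW F_cont w0 w t]
  have "((\<lambda>s. T (- s) (w s - ws) \<bullet> T (- s) (w s - ws)) has_vector_derivative
      T (- t) (w t - ws) \<bullet> - T (- t) (F (w t) - F ws) + - T (- t) (F (w t) - F ws) \<bullet> T (- t) (w t - ws)) (at t within {0..})"
    by (rule bounded_bilinear.has_vector_derivative[OF bounded_bilinear_inner z z])
  then have "((\<lambda>s. T (- s) (w s - ws) \<bullet> T (- s) (w s - ws)) has_real_derivative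
      - 2 * ((w t - ws) \<bullet> (F (w t) - F ws))) (at t within {0..})"
    using vW[OF t] gW by (simp add: T_inner has_real_derivative_iff_has_vector_derivative inner_commute)
  then show ?thesis
    by (rule has_field_derivative_transform_within[where d = 1]) (use t vW in \<open>auto simp: T_inner\<close>)
qed

end

section \<open>Exponential stability of primal-dual dynamics\<close>

text \<open>
  Here \<open>G\<close> is a right inverse of the second component of \<open>J\<close>, restricted to states without adjoint
  part, and the last assumption on \<open>J\<close> makes it two-sided.
\<close>

lemma primal_dual_exponentially_stable:
  fixes X :: "'a::real_inner set" and Z :: "'b::real_inner set"
    and T :: "real \<Rightarrow> 'a \<times> 'b \<Rightarrow> 'a \<times> 'b" and R1 :: "'a \<Rightarrow> 'a" and R2 :: "'b \<Rightarrow> 'b"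
    and c :: "'a \<times> 'b"
  defines "F \<equiv> \<lambda>w. (R1 (fst w), R2 (snd w)) + c"
  assumes X: "subspace X" and Z: "subspace Z" and c: "c \<in> X \<times> Z"
    and grp: "unitary_C0_group (X \<times> Z) T" and gen: "is_generator (X \<times> Z) T D J"
    and G: "\<And>p. p \<in> Z \<Longrightarrow> (G p, 0) \<in> D \<and> J (G p, 0) = (0, p) \<and> norm (G p) \<le> C * norm p"
    and G_adj: "\<And>f. f \<in> X \<Longrightarrow> \<exists>q. (0, q) \<in> D \<and> J (0, q) = (- f, 0)"
    and R1: "\<And>x. x \<in> X \<Longrightarrow> R1 x \<in> X" and R2: "\<And>p. p \<in> Z \<Longrightarrow> R2 p \<in> Z"
    and \<mu>: "\<mu> > 0"
    and R1_mono: "\<And>x y. x \<in> X \<Longrightarrow> y \<in> X \<Longrightarrow> \<mu> * (norm (x - y))\<^sup>2 \<le> (R1 x - R1 y) \<bullet> (x - y)"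
    and R2_mono: "\<And>p q. p \<in> Z \<Longrightarrow> q \<in> Z \<Longrightarrow> 0 \<le> (R2 p - R2 q) \<bullet> (p - q)"
    and R1_lip: "\<And>x y. x \<in> X \<Longrightarrow> y \<in> X \<Longrightarrow> norm (R1 x - R1 y) \<le> N * norm (x - y)"
    and R2_lip: "\<And>p q. p \<in> Z \<Longrightarrow> q \<in> Z \<Longrightarrow> norm (R2 p - R2 q) \<le> N * norm (p - q)"
    and C: "C > 0" and N: "N > 0"
    and ws: "ws \<in> D" "J ws = F ws"
  shows "\<exists>\<eta>>0. \<forall>w0 \<in> X \<times> Z. \<forall>w. mild_solution (X \<times> Z) T F w0 w \<longrightarrow>
    (\<forall>t\<ge>0. norm (w t - ws) \<le> 2 * exp (- \<eta> * t) * norm (w0 - ws))"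
proof -
  have W: "subspace (X \<times> Z)" using X Z by (rule subspace_Times)
  interpret unitary_group "X \<times> Z" T D J by unfold_locales (rule W grp gen)+
  have Z0: "0 \<in> Z" and X0: "0 \<in> X" using X Z by (auto simp: subspace_0)
  have GX: "G p \<in> X" if "p \<in> Z" for p using G[OF that] D_W by auto
  \<comment> \<open>\<open>q\<close> is the value at \<open>f\<close> of the adjoint of
    \<open>G\<close>; the identity is skew-symmetry of \<open>J\<close> between
    \<open>(G p, 0)\<close> and \<open>(0, q)\<close>.\<close>
  have adj: "\<exists>q. (0, q) \<in> D \<and> q \<in> Z \<and> J (0, q) = (- f, 0) \<and> (\<forall>p\<in>Z. G p \<bullet> f = p \<bullet> q)" if f: "f \<in> X" for f
  proof -
    obtain q where q: "(0, q) \<in> D" "J (0, q) = (- f, 0)" using G_adj[OF f] by auto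
    have "G p \<bullet> f = p \<bullet> q" if "p \<in> Z" for p
      using J_skew[of "(G p, 0)" "(0, q)"] G[OF that] q by simp
    then show ?thesis using q D_W by auto
  qed
  \<comment> \<open>\<open>G\<close> is a mere choice of preimages. Its additivity follows from the
    adjoint identity, tested with the defect \<open>f\<close> itself.\<close>
  have G_diff: "G p - G q = G (p - q)" if p: "p \<in> Z" "q \<in> Z" for p q
  proof -
    define f where "f = G p - G q - G (p - q)"
    have f: "f \<in> X" unfolding f_def using p X Z by (intro subspace_diff GX) auto
    from adj[OF f] obtain r where r: "\<forall>p\<in>Z. G p \<bullet> f = p \<bullet> r" by auto
    have "f \<bullet> f = G p \<bullet> f - G q \<bullet> f - G (p - q) \<bullet> f" by (simp add: f_def inner_diff_left)
    also have "\<dots> = 0" using r p subspace_diff[OF Z] by (simp add: inner_diff_left)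
    finally show ?thesis by (simp add: f_def)
  qed
  have F: "\<And>w. w \<in> X \<times> Z \<Longrightarrow> F w \<in> X \<times> Z"
    unfolding F_def using R1 R2 c X Z by (auto intro!: subspace_add[OF W])
  then have FW: "F ` (X \<times> Z) \<subseteq> X \<times> Z" by (rule image_subsetI)
  have lip_cont: "continuous_on S f" if "\<And>x y. x \<in> S \<Longrightarrow> y \<in> S \<Longrightarrow> norm (f x - f y) \<le> K * norm (x - y)" "K > 0"
    for f :: "'x::real_normed_vector \<Rightarrow> 'y::real_normed_vector" and S K
    by (rule lipschitz_on_continuous_on[of K]) (use that in \<open>auto simp: lipschitz_on_def dist_norm\<close>)
  have "continuous_on X R1" "continuous_on Z R2" "continuous_on Z G"
    using lip_cont[of X R1 N] lip_cont[of Z R2 N] lip_cont[of Z G C] R1_lip R2_lip G_diff G subspace_diff[OF Z] N C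
    by auto
  then have cont: "continuous_on (X \<times> Z) F" and G_cont: "continuous_on Z G"
    unfolding F_def
    by (auto intro!: continuous_intros elim: continuous_on_compose2[OF _ continuous_on_fst[OF continuous_on_id]]
        continuous_on_compose2[OF _ continuous_on_snd[OF continuous_on_id]])
  have wsW: "ws \<in> X \<times> Z" using ws D_W by auto
  define K where "K = C * N"
  have K: "K > 0" using C N by (simp add: K_def)
  \<comment> \<open>The first entry keeps the cross term below half of the squared norm. The second
    makes \<mu> absorb the \<open>x\<close>-terms created by the cross term: 2 from
    \<open>x \<bullet> x\<close> and \<open>4 * K\<^sup>2\<close> from Young's inequality.\<close>
  define \<epsilon> where "\<epsilon> = min (1 / (2 * C)) (\<mu> / (2 + 4 * K\<^sup>2))"
  have K2: "2 + 4 * K\<^sup>2 > 0" by (simp add: add_pos_nonneg)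
  have \<epsilon>: "\<epsilon> > 0" using C \<mu> K2 by (simp add: \<epsilon>_def)
  have \<epsilon>1: "2 * \<epsilon> * C \<le> 1"
    using C by (simp add: \<epsilon>_def min_def field_simps)
  have "\<epsilon> \<le> \<mu> / (2 + 4 * K\<^sup>2)" by (simp add: \<epsilon>_def)
  then have \<epsilon>2: "2 * \<epsilon> + 4 * \<epsilon> * K\<^sup>2 \<le> \<mu>" using K2 by (simp add: pos_le_divide_eq algebra_simps)
  moreover have "4 * \<epsilon> * K\<^sup>2 \<ge> 0" using \<epsilon> by simp
  ultimately have \<epsilon>3: "\<epsilon> \<le> \<mu>" using \<epsilon> by linarith
  have main: "norm (w t - ws) \<le> 2 * exp (- (\<epsilon> / 3) * t) * norm (w0 - ws)"
    if w0: "w0 \<in> X \<times> Z" and w: "mild_solution (X \<times> Z) T F w0 w" and t0: "t \<ge> 0" for w0 w t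
  proof -
    define x where "x s = fst (w s - ws)" for s
    define p where "p s = snd (w s - ws)" for s
    define a where "a s = fst (F (w s) - F ws)" for s
    define b where "b s = snd (F (w s) - F ws)" for s
    have v: "w s - ws = (x s, p s)" and g: "F (w s) - F ws = (a s, b s)" for s
      by (simp_all add: x_def p_def a_def b_def prod_eq_iff)
    have wW: "\<And>s. s \<ge> 0 \<Longrightarrow> w s \<in> X \<times> Z" and wc: "continuous_on {0..} w"
      using w unfolding mild_solution_def by auto
    have xX: "x s \<in> X" and pZ: "p s \<in> Z" and aX: "a s \<in> X" and bZ: "b s \<in> Z" if "s \<ge> 0" for s
      using subspace_diff[OF W wW[OF that] wsW] subspace_diff[OF W F[OF wW[OF that]] F[OF wsW]]
      unfolding v g by auto
    have xc: "continuous_on {0..} x" and pc: "continuous_on {0..} p"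
      unfolding x_def p_def using wc by (auto intro!: continuous_intros)
    have ac: "continuous_on {0..} a" and bc: "continuous_on {0..} b"
    proof -
      have "continuous_on {0..} (\<lambda>s. F (w s))"
        by (rule continuous_on_compose2[OF cont wc]) (use wW in \<open>simp add: image_subset_iff\<close>)
      then show "continuous_on {0..} a" "continuous_on {0..} b"
        unfolding a_def b_def by (auto intro!: continuous_intros)
    qed
    note D1 = mild_solution_inner_has_derivative[OF ws FW cont w0 w, unfolded v g]
    note D2 = mild_solution_norm_has_derivative[OF ws FW cont w0 w, unfolded v g]
    \<comment> \<open>Formally \<open>(G p)' = G (A_op x - b) = x - G b\<close>. Rigorously,
      \<open>p\<close> is differentiable against \<open>q\<close> with \<open>(0, q)\<close> in the
      domain, and the adjoint identity makes these sufficient to test \<open>G p\<close> with every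
      \<open>f\<close> in \<open>X\<close>.\<close>
    have G_deriv: "((\<lambda>s. G (p s)) has_vector_derivative x s - G (b s)) (at s within {0..})" if s: "s \<ge> 0" for s
    proof (rule has_vector_derivative_weak_imp_strong[OF X _ _ _ _ s])
      show "\<And>t. 0 \<le> t \<Longrightarrow> G (p t) \<in> X" using GX pZ by auto
      show "\<And>t. 0 \<le> t \<Longrightarrow> x t - G (b t) \<in> X" using GX xX bZ subspace_diff[OF X] by auto
      show "continuous_on {0..} (\<lambda>t. x t - G (b t))"
        using bZ by (intro continuous_intros xc continuous_on_compose2[OF G_cont bc]) auto
      fix f t assume f: "f \<in> X" and t: "(t::real) \<ge> 0"
      obtain q where q: "(0, q) \<in> D" "q \<in> Z" "J (0, q) = (- f, 0)" "\<And>p. p \<in> Z \<Longrightarrow> G p \<bullet> f = p \<bullet> q"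
        using adj[OF f] by auto
      have "((\<lambda>t. p t \<bullet> q) has_real_derivative x t \<bullet> f - b t \<bullet> q) (at t within {0..})"
        using D1[OF t q(1)] q X0 Z0 f subspace_neg[OF X] by simp
      then have "((\<lambda>t. G (p t) \<bullet> f) has_real_derivative x t \<bullet> f - b t \<bullet> q) (at t within {0..})"
        by (rule has_field_derivative_transform_within[where d = 1]) (use q(4) pZ t in auto)
      then show "((\<lambda>t. G (p t) \<bullet> f) has_real_derivative (x t - G (b t)) \<bullet> f) (at t within {0..})"
        using q(4) bZ[OF t] by (simp add: inner_diff_left)
    qed
    \<comment> \<open>With \<open>G (p s)\<close> frozen, \<open>(G (p s), 0)\<close> lies in the
      domain, so \<open>x\<close> tested with it is differentiable; this is where
      \<open>- (p s \<bullet> p s)\<close> arises.\<close>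
    have cross: "((\<lambda>s. x s \<bullet> G (p s)) has_real_derivative
        x s \<bullet> (x s - G (b s)) + (- (p s \<bullet> p s) - a s \<bullet> G (p s))) (at s within {0..})" if s: "s \<ge> 0" for s
    proof (rule has_real_derivative_inner_continuous[OF _ G_deriv[OF s]])
      show "continuous (at s within {0..}) x" using xc s by (simp add: continuous_on_eq_continuous_within)
      show "((\<lambda>t. x t \<bullet> G (p s)) has_real_derivative - (p s \<bullet> p s) - a s \<bullet> G (p s)) (at s within {0..})"
        using D1[OF s, of "(G (p s), 0)"] G[OF pZ[OF s]] X0 pZ[OF s] by simp
    qed
    define V where "V s = x s \<bullet> x s + p s \<bullet> p s + 2 * \<epsilon> * (x s \<bullet> G (p s))" for s
    have amgm: "2 * A * B \<le> A\<^sup>2 + B\<^sup>2" for A B :: real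
      using sum_squares_bound[of A B] by simp
    \<comment> \<open>Hence \<open>V\<close> lies between one half and three halves of the squared
      norm of the deviation.\<close>
    have bound: "\<bar>2 * \<epsilon> * (x s \<bullet> G (p s))\<bar> \<le> (x s \<bullet> x s + p s \<bullet> p s) / 2" if s: "s \<ge> 0" for s
    proof -
      have "\<bar>2 * \<epsilon> * (x s \<bullet> G (p s))\<bar> = 2 * \<epsilon> * \<bar>x s \<bullet> G (p s)\<bar>" using \<epsilon> by (simp add: abs_mult)
      also have "\<dots> \<le> 2 * \<epsilon> * (norm (x s) * (C * norm (p s)))"
        using \<epsilon> G[OF pZ[OF s]]
        by (intro mult_left_mono order_trans[OF Cauchy_Schwarz_ineq2]) auto
      also have "\<dots> = (2 * \<epsilon> * C) * (norm (x s) * norm (p s))" by simp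
      also have "\<dots> \<le> 1 * (norm (x s) * norm (p s))" using \<epsilon>1 by (intro mult_right_mono) auto
      also have "\<dots> \<le> (x s \<bullet> x s + p s \<bullet> p s) / 2"
        using amgm[of "norm (x s)" "norm (p s)"] by (simp add: dot_square_norm)
      finally show ?thesis .
    qed
    have "V t \<le> exp (- (2 * \<epsilon> / 3) * t) * V 0"
    proof (rule exponential_decay_if_deriv_le[OF _ t0])
      fix s :: real assume s: "s \<ge> 0"
      let ?D = "- 2 * (x s \<bullet> a s + p s \<bullet> b s)
        + 2 * \<epsilon> * (x s \<bullet> (x s - G (b s)) + (- (p s \<bullet> p s) - a s \<bullet> G (p s)))"
      have "(V has_real_derivative ?D) (at s within {0..})"
        unfolding V_def using DERIV_add[OF D2[OF s] DERIV_cmult[OF cross[OF s], of "2 * \<epsilon>"]] by simp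
      moreover have "?D \<le> - (2 * \<epsilon> / 3) * V s"
      proof -
        let ?x = "norm (x s)" and ?p = "norm (p s)"
        have wsX: "fst ws \<in> X" "snd ws \<in> Z" "fst (w s) \<in> X" "snd (w s) \<in> Z" using wsW wW[OF s] by auto
        have 1: "\<mu> * ?x\<^sup>2 \<le> x s \<bullet> a s" "0 \<le> p s \<bullet> b s" and la: "norm (a s) \<le> N * ?x" and lb: "norm (b s) \<le> N * ?p"
          using R1_mono[of "fst (w s)" "fst ws"] R2_mono[of "snd (w s)" "snd ws"]
            R1_lip[of "fst (w s)" "fst ws"] R2_lip[of "snd (w s)" "snd ws"] wsX
          unfolding x_def p_def a_def b_def F_def by (simp_all add: inner_commute)
        have Gb: "norm (G (b s)) \<le> K * ?p" 
          using order_trans[OF conjunct2[OF conjunct2[OF G[OF bZ[OF s]]]] mult_left_mono[OF lb, of C]] C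
          by (simp add: K_def algebra_simps)
        have 2: "- (x s \<bullet> G (b s)) \<le> K * ?x * ?p"
          using Cauchy_Schwarz_ineq2[of "x s" "G (b s)"] mult_left_mono[OF Gb, of ?x]
          by (simp add: algebra_simps)
        have "\<bar>a s \<bullet> G (p s)\<bar> \<le> norm (a s) * norm (G (p s))" by (rule Cauchy_Schwarz_ineq2)
        also have "\<dots> \<le> (N * ?x) * (C * ?p)"
          using la G[OF pZ[OF s]] N by (intro mult_mono) auto
        finally have 3: "- (a s \<bullet> G (p s)) \<le> K * ?x * ?p" by (simp add: K_def algebra_simps)
        \<comment> \<open>The weight is chosen so that Young's inequality spends exactly one of the
          two available copies of \<open>?p\<^sup>2\<close>.\<close>
        have 4: "4 * (K * ?x * ?p) \<le> 4 * K\<^sup>2 * ?x\<^sup>2 + ?p\<^sup>2"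
          using amgm[of "2 * K * ?x" ?p] by (simp add: power_mult_distrib algebra_simps)
        have "2 * (x s \<bullet> (x s - G (b s)) + (- (p s \<bullet> p s) - a s \<bullet> G (p s)))
            \<le> 2 * ?x\<^sup>2 + 4 * K\<^sup>2 * ?x\<^sup>2 - ?p\<^sup>2"
          using 2 3 4 by (simp add: inner_diff_right dot_square_norm)
        then have "\<epsilon> * (2 * (x s \<bullet> (x s - G (b s)) + (- (p s \<bullet> p s) - a s \<bullet> G (p s))))
            \<le> \<epsilon> * (2 * ?x\<^sup>2 + 4 * K\<^sup>2 * ?x\<^sup>2 - ?p\<^sup>2)" using \<epsilon> by (intro mult_left_mono) auto
        also have "\<dots> = (2 * \<epsilon> + 4 * \<epsilon> * K\<^sup>2) * ?x\<^sup>2 - \<epsilon> * ?p\<^sup>2" by (simp add: algebra_simps)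
        also have "\<dots> \<le> \<mu> * ?x\<^sup>2 - \<epsilon> * ?p\<^sup>2" using \<epsilon>2 by (simp add: mult_right_mono)
        finally have "?D \<le> - \<mu> * ?x\<^sup>2 - \<epsilon> * ?p\<^sup>2" using 1 by (simp add: algebra_simps)
        also have "\<dots> \<le> - \<epsilon> * (x s \<bullet> x s + p s \<bullet> p s)"
          using mult_right_mono[OF \<epsilon>3, of "?x\<^sup>2"] by (simp add: dot_square_norm algebra_simps)
        also have "\<dots> \<le> - (2 * \<epsilon> / 3) * V s"
        proof -
          have "V s \<le> 3/2 * (x s \<bullet> x s + p s \<bullet> p s)" using bound[OF s] by (simp add: V_def abs_le_iff)
          from mult_left_mono[OF this, of "2 * \<epsilon> / 3"] \<epsilon> show ?thesis by simp
        qed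
        finally show ?thesis .
      qed
      ultimately show "\<exists>D. (V has_real_derivative D) (at s within {0..}) \<and> D \<le> - (2 * \<epsilon> / 3) * V s" by blast
    qed
    moreover have "V t \<ge> (norm (w t - ws))\<^sup>2 / 2"
      using bound[OF t0] unfolding v by (simp add: V_def abs_le_iff flip: dot_square_norm)
    moreover have "w 0 = w0"
      using w w0 T_0 unfolding mild_solution_def by auto
    then have "V 0 \<le> 3/2 * (norm (w0 - ws))\<^sup>2"
      using bound[of 0] v[of 0] by (simp add: V_def abs_le_iff flip: dot_square_norm)
    then have "exp (- (2 * \<epsilon> / 3) * t) * V 0 \<le> exp (- (2 * \<epsilon> / 3) * t) * (3/2 * (norm (w0 - ws))\<^sup>2)"
      by (intro mult_left_mono) auto
    \<comment> \<open>The factor 3 is the ratio of the constants 3/2 and 1/2 in the bounds on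
      \<open>V\<close>; it is enlarged to 4 so that the square root is 2. The root also halves the
      rate to \<open>\<epsilon> / 3\<close>.\<close>
    ultimately have "(norm (w t - ws))\<^sup>2 \<le> 3 * (exp (- (2 * \<epsilon> / 3) * t) * (norm (w0 - ws))\<^sup>2)"
      by linarith
    also have "\<dots> \<le> 4 * (exp (- (2 * \<epsilon> / 3) * t) * (norm (w0 - ws))\<^sup>2)" by (intro mult_right_mono) auto
    also have "\<dots> = (2 * exp (- (\<epsilon> / 3) * t) * norm (w0 - ws))\<^sup>2"
      by (simp add: power_mult_distrib flip: exp_double)
    finally show ?thesis by (rule power2_le_imp_le) auto
  qed
  show ?thesis by (rule exI[of _ "\<epsilon> / 3"]) (use \<epsilon> main in auto)
qed

section \<open>Convex gradients and projections\<close>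

text \<open>The potential is essential: a skew linear map satisfies both one-sided bounds for every
  \<open>L\<close> and may have any norm. Along lines, \<open>mono\<close> gives the tangent bound
  from below and \<open>bound\<close> the quadratic bound from above; together they yield
  cocoercivity of the gradient, which is then combined with \<open>bound\<close>.\<close>

lemma convex_gradient_lipschitz:
  fixes f :: "'a::real_inner \<Rightarrow> real" and G :: "'a \<Rightarrow> 'a"
  assumes S: "subspace S" and G: "\<And>x. x \<in> S \<Longrightarrow> G x \<in> S"
    and f: "\<And>x. x \<in> S \<Longrightarrow> (f has_derivative (\<lambda>h. G x \<bullet> h)) (at x within S)"
    and L: "L > 0"
    and mono: "\<And>x y. x \<in> S \<Longrightarrow> y \<in> S \<Longrightarrow> 0 \<le> (G x - G y) \<bullet> (x - y)"
    and bound: "\<And>x y. x \<in> S \<Longrightarrow> y \<in> S \<Longrightarrow> (G x - G y) \<bullet> (x - y) \<le> L * (norm (x - y))\<^sup>2"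
    and xy: "x \<in> S" "y \<in> S"
  shows "norm (G x - G y) \<le> L * norm (x - y)"
proof -
  have line: "((\<lambda>t. f (x + t *\<^sub>R d)) has_real_derivative G (x + t *\<^sub>R d) \<bullet> d) (at t)"
    if "x \<in> S" "d \<in> S" for x d t
  proof -
    have in_S: "x + t *\<^sub>R d \<in> S" for t using that S by (intro subspace_add subspace_scale)
    have "((\<lambda>t. x + t *\<^sub>R d) has_derivative (\<lambda>t. t *\<^sub>R d)) (at t)"
      by (auto intro!: derivative_eq_intros)
    moreover have "(f has_derivative (\<lambda>h. G (x + t *\<^sub>R d) \<bullet> h)) (at (x + t *\<^sub>R d) within range (\<lambda>t. x + t *\<^sub>R d))"
      by (rule has_derivative_subset[OF f[OF in_S]]) (use in_S in auto)
    ultimately have "((\<lambda>t. f (x + t *\<^sub>R d)) has_derivative (\<lambda>t'. G (x + t *\<^sub>R d) \<bullet> t' *\<^sub>R d)) (at t)"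
      by (rule has_derivative_in_compose)
    then show ?thesis
      by (rule has_derivative_imp_has_field_derivative) (simp add: mult.commute)
  qed
  have lower: "f x + G x \<bullet> d \<le> f (x + d)" if x: "x \<in> S" and d: "d \<in> S" for x d
  proof -
    have "f (x + 0 *\<^sub>R d) - 0 * (G x \<bullet> d) \<le> f (x + 1 *\<^sub>R d) - 1 * (G x \<bullet> d)"
    proof (rule DERIV_nonneg_imp_nondecreasing[where f = "\<lambda>t. f (x + t *\<^sub>R d) - t * (G x \<bullet> d)"])
      fix t :: real assume t: "0 \<le> t" "t \<le> 1"
      have "t * ((G (x + t *\<^sub>R d) - G x) \<bullet> d) \<ge> 0"
        using mono[of "x + t *\<^sub>R d" x] x d S by (simp add: subspace_add subspace_scale)
      then have "(G (x + t *\<^sub>R d) - G x) \<bullet> d \<ge> 0"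
        using t by (cases "t = 0") (auto simp: zero_le_mult_iff)
      then show "\<exists>D. ((\<lambda>t. f (x + t *\<^sub>R d) - t * (G x \<bullet> d)) has_real_derivative D) (at t) \<and> 0 \<le> D"
        by (intro exI[of _ "(G (x + t *\<^sub>R d) - G x) \<bullet> d"])
          (auto intro!: derivative_eq_intros line x d simp: inner_diff_left)
    qed simp
    then show ?thesis by simp
  qed
  have upper: "f (x + d) \<le> f x + G x \<bullet> d + L / 2 * (norm d)\<^sup>2" if x: "x \<in> S" and d: "d \<in> S" for x d
  proof -
    let ?h = "\<lambda>t. f (x + t *\<^sub>R d) - t * (G x \<bullet> d) - t\<^sup>2 * (L / 2 * (norm d)\<^sup>2)"
    have "?h 1 \<le> ?h 0"
    proof (rule DERIV_nonpos_imp_nonincreasing[where f = ?h])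
      fix t :: real assume t: "0 \<le> t" "t \<le> 1"
      have "t * ((G (x + t *\<^sub>R d) - G x) \<bullet> d) \<le> t * (t * (L * (norm d)\<^sup>2))"
        using bound[of "x + t *\<^sub>R d" x] x d S
        by (simp add: subspace_add subspace_scale power_mult_distrib power2_eq_square ac_simps)
      then have "(G (x + t *\<^sub>R d) - G x) \<bullet> d - t * (L * (norm d)\<^sup>2) \<le> 0"
        using t by (cases "t = 0") (auto simp: mult_le_cancel_left)
      then show "\<exists>D. (?h has_real_derivative D) (at t) \<and> D \<le> 0"
        by (intro exI[of _ "(G (x + t *\<^sub>R d) - G x) \<bullet> d - t * (L * (norm d)\<^sup>2)"])
          (auto intro!: derivative_eq_intros line x d simp: inner_diff_left)
    qed simp
    then show ?thesis by simp
  qed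
  have key: "f x + G x \<bullet> (y - x) + (norm (G y - G x))\<^sup>2 / (2 * L) \<le> f y" if x: "x \<in> S" and y: "y \<in> S" for x y
  proof -
    define D where "D = G y - G x"
    have D: "D \<in> S" unfolding D_def using x y S G by (intro subspace_diff) auto
    \<comment> \<open>This step from \<open>y\<close> minimises the quadratic upper bound at
      \<open>y\<close> minus the tangent of \<open>f\<close> at \<open>x\<close>.\<close>
    let ?d = "- (1 / L) *\<^sub>R D"
    have d: "?d \<in> S" using D S by (intro subspace_scale)
    have "f x + G x \<bullet> (y + ?d - x) \<le> f (x + (y + ?d - x))"
      using x y d S by (intro lower subspace_diff subspace_add)
    then have "f x + G x \<bullet> (y - x) + G x \<bullet> ?d \<le> f (y + ?d)"
      by (simp only: inner_diff_right inner_add_right add_diff_cancel_left' add_diff_eq diff_add_eq[symmetric])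
        (simp add: algebra_simps)
    also have "\<dots> \<le> f y + G y \<bullet> ?d + L / 2 * (norm ?d)\<^sup>2" by (rule upper[OF y d])
    also have "L / 2 * (norm ?d)\<^sup>2 = (norm D)\<^sup>2 / (2 * L)"
      using L by (simp add: power_mult_distrib power2_eq_square field_simps)
    finally have "f x + G x \<bullet> (y - x) + G x \<bullet> ?d \<le> f y + G y \<bullet> ?d + (norm D)\<^sup>2 / (2 * L)" .
    moreover have "G y \<bullet> ?d - G x \<bullet> ?d = - ((norm D)\<^sup>2 / L)"
      unfolding inner_diff_left[symmetric] D_def[symmetric] by (simp add: dot_square_norm)
    moreover have "(norm D)\<^sup>2 / L = 2 * ((norm D)\<^sup>2 / (2 * L))" by simp
    ultimately show ?thesis unfolding D_def[symmetric] by linarith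
  qed
  \<comment> \<open>Adding \<open>key\<close> for both orders of the points cancels the function
    values.\<close>
  have "(norm (G y - G x))\<^sup>2 / (2 * L) + (norm (G x - G y))\<^sup>2 / (2 * L) \<le> (G x - G y) \<bullet> (x - y)"
    using key[OF xy] key[OF xy(2,1)] by (simp add: inner_diff_left inner_diff_right)
  also have "\<dots> \<le> L * (norm (x - y))\<^sup>2" by (rule bound[OF xy])
  finally have "(norm (G x - G y))\<^sup>2 / L \<le> L * (norm (x - y))\<^sup>2"
    by (simp add: norm_minus_commute)
  then have "(norm (G x - G y))\<^sup>2 \<le> (L * norm (x - y))\<^sup>2"
    using L by (simp add: field_simps power2_eq_square)
  then show ?thesis by (rule power2_le_imp_le) (use L in auto)
qed

section \<open>Projections onto convex sets\<close>

text \<open>If the inner product were positive, a small move from the projection towards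
  \<open>y\<close> would stay in \<open>S\<close> and come closer to \<open>a\<close>. Existence of
  a closest point is assumed for the point \<open>a\<close> alone.\<close>

lemma orth_proj_variational:
  fixes S :: "'a::real_inner set"
  assumes S: "convex S" and ex: "\<exists>x\<in>S. \<forall>y\<in>S. dist a x \<le> dist a y"
  shows "orth_proj S a \<in> S" "y \<in> S \<Longrightarrow> (a - orth_proj S a) \<bullet> (y - orth_proj S a) \<le> 0"
proof -
  have *: "orth_proj S a \<in> S \<and> (\<forall>y\<in>S. dist a (orth_proj S a) \<le> dist a y)"
    unfolding orth_proj_def by (rule someI_ex) (use ex in auto)
  then show "orth_proj S a \<in> S" by simp
  assume y: "y \<in> S"
  show "(a - orth_proj S a) \<bullet> (y - orth_proj S a) \<le> 0"
  proof (rule ccontr)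
    let ?p = "orth_proj S a"
    assume "\<not> ?thesis"
    then obtain u where u: "u > 0" "u \<le> 1" "dist (?p + u *\<^sub>R (y - ?p)) a < dist ?p a"
      using closer_point_lemma[of a ?p y] by auto
    have "?p + u *\<^sub>R (y - ?p) = (1 - u) *\<^sub>R ?p + u *\<^sub>R y" by (simp add: algebra_simps)
    also have "\<dots> \<in> S" using S * y u by (intro convexD) auto
    finally show False using * u(3) by (force simp: dist_commute)
  qed
qed

text \<open>Each projection serves as test point in the variational inequality of the other, and the
  two are added. This is the source of the monotonicity of the control term.\<close>

lemma orth_proj_firmly_nonexpansive:
  fixes S :: "'a::real_inner set"
  assumes S: "convex S" and a: "\<exists>x\<in>S. \<forall>y\<in>S. dist a x \<le> dist a y" and b: "\<exists>x\<in>S. \<forall>y\<in>S. dist b x \<le> dist b y"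
  shows "(norm (orth_proj S a - orth_proj S b))\<^sup>2 \<le> (orth_proj S a - orth_proj S b) \<bullet> (a - b)"
proof -
  note pa = orth_proj_variational[OF S a] and pb = orth_proj_variational[OF S b]
  have "(a - orth_proj S a) \<bullet> (orth_proj S b - orth_proj S a) \<le> 0"
    "(b - orth_proj S b) \<bullet> (orth_proj S a - orth_proj S b) \<le> 0"
    using pa(2)[OF pb(1)] pb(2)[OF pa(1)] by simp_all
  then show ?thesis
    by (simp add: power2_norm_eq_inner inner_diff_left inner_diff_right inner_commute)
qed

lemma orth_proj_nonexpansive:
  fixes S :: "'a::real_inner set"
  assumes S: "convex S" and a: "\<exists>x\<in>S. \<forall>y\<in>S. dist a x \<le> dist a y" and b: "\<exists>x\<in>S. \<forall>y\<in>S. dist b x \<le> dist b y"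
  shows "norm (orth_proj S a - orth_proj S b) \<le> norm (a - b)"
proof -
  let ?d = "orth_proj S a - orth_proj S b"
  have "norm ?d * norm ?d \<le> norm ?d * norm (a - b)"
    using orth_proj_firmly_nonexpansive[OF S a b] norm_cauchy_schwarz[of ?d "a - b"]
    by (simp add: power2_eq_square)
  then show ?thesis by (cases "norm ?d = 0") (auto simp: mult_le_cancel_left)
qed

section \<open>Square-integrable functions\<close>

lemma square_integrable_rep_L2: "square_integrable (rep_L2 x)"
  using Quotient3_rep_reflp[OF Quotient3_L2, of x] by simp

lemma rep_L2_abs_L2:
  assumes "square_integrable f"
  shows "AE t in lebesgue. rep_L2 (abs_L2 f) t = f t"
  using rep_abs_rsp_left[OF Quotient3_L2, of f f] assms by simp

lemma L2_eqI:
  assumes "AE t in lebesgue. rep_L2 x t = rep_L2 y t"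
  shows "x = y"
  using Quotient3_rel_rep[OF Quotient3_L2, of x y] assms square_integrable_rep_L2 by auto

lemma rep_L2_measurable [measurable]: "rep_L2 x \<in> borel_measurable lebesgue"
  using square_integrable_rep_L2[of x] by (simp add: square_integrable_def)

lemma rep_L2_zero: "AE t in lebesgue. rep_L2 0 t = 0"
  unfolding zero_L2_def by (rule rep_L2_abs_L2) (rule square_integrable_0)

lemma rep_L2_add: "AE t in lebesgue. rep_L2 (x + y) t = rep_L2 x t + rep_L2 y t"
  unfolding plus_L2_def map_fun_apply
  by (rule rep_L2_abs_L2) (intro square_integrable_add square_integrable_rep_L2)

lemma rep_L2_diff: "AE t in lebesgue. rep_L2 (x - y) t = rep_L2 x t - rep_L2 y t"
  unfolding minus_L2_def map_fun_apply
  by (rule rep_L2_abs_L2) (intro square_integrable_diff square_integrable_rep_L2)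

lemma rep_L2_uminus: "AE t in lebesgue. rep_L2 (- x) t = - rep_L2 x t"
  unfolding uminus_L2_def map_fun_apply
  by (rule rep_L2_abs_L2) (intro square_integrable_minus square_integrable_rep_L2)

lemma rep_L2_scaleR: "AE t in lebesgue. rep_L2 (c *\<^sub>R x) t = c *\<^sub>R rep_L2 x t"
  unfolding scaleR_L2_def map_fun_apply id_apply
  by (rule rep_L2_abs_L2) (intro square_integrable_scaleR square_integrable_rep_L2)

lemma rep_L2_mat: "AE t in lebesgue. rep_L2 (mat_L2 A x) t = A *v rep_L2 x t"
  unfolding mat_L2_def map_fun_apply id_apply
  by (rule rep_L2_abs_L2[OF square_integrable_bounded_linear[OF matrix_vector_mul_bounded_linear
          square_integrable_rep_L2]])

lemma inner_L2_eq: "x \<bullet> y = (LINT t|lebesgue. rep_L2 x t \<bullet> rep_L2 y t)"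
  unfolding inner_L2_def by simp

lemma norm_L2_power2: "(norm x)\<^sup>2 = (LINT t|lebesgue. (norm (rep_L2 x t))\<^sup>2)"
  by (simp add: power2_norm_eq_inner inner_L2_eq)

lemma integrable_norm_rep_L2_power2: "integrable lebesgue (\<lambda>t. (norm (rep_L2 x t))\<^sup>2)"
  using square_integrable_rep_L2[of x] by (simp add: square_integrable_def)

lemma norm_L2_le:
  assumes "AE t in lebesgue. norm (rep_L2 x t) \<le> c * norm (rep_L2 y t)" and c: "c \<ge> 0"
  shows "norm x \<le> c * norm y"
proof -
  have "(norm x)\<^sup>2 \<le> (LINT t|lebesgue. c\<^sup>2 * (norm (rep_L2 y t))\<^sup>2)"
    unfolding norm_L2_power2
  proof (rule integral_mono_AE)
    show "AE t in lebesgue. (norm (rep_L2 x t))\<^sup>2 \<le> c\<^sup>2 * (norm (rep_L2 y t))\<^sup>2"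
      using assms(1) by eventually_elim (auto simp flip: power_mult_distrib intro: power_mono)
  qed (auto intro: integrable_norm_rep_L2_power2)
  also have "\<dots> = (c * norm y)\<^sup>2" by (simp add: norm_L2_power2 power_mult_distrib)
  finally show ?thesis by (rule power2_le_imp_le) (use c in auto)
qed

lemma subspace_L2_on: "subspace (L2_on S)"
proof (rule subspaceI)
  show "0 \<in> L2_on S" unfolding L2_on_def using rep_L2_zero by auto
  show "x + y \<in> L2_on S" if "x \<in> L2_on S" "y \<in> L2_on S" for x y :: "'a L2"
    using that rep_L2_add[of x y] unfolding L2_on_def mem_Collect_eq
    by eventually_elim auto
  show "c *\<^sub>R x \<in> L2_on S" if "x \<in> L2_on S" for c and x :: "'a L2"
    using that rep_L2_scaleR[of c x] unfolding L2_on_def mem_Collect_eq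
    by eventually_elim auto
qed

lemma mat_L2_in_L2_on:
  assumes "x \<in> L2_on S" shows "mat_L2 A x \<in> L2_on S"
  using assms rep_L2_mat[of A x] unfolding L2_on_def mem_Collect_eq
  by eventually_elim auto

lemma mat_L2_diff: "mat_L2 A (x - y) = mat_L2 A x - mat_L2 A y"
proof (rule L2_eqI)
  show "AE t in lebesgue. rep_L2 (mat_L2 A (x - y)) t = rep_L2 (mat_L2 A x - mat_L2 A y) t"
    using rep_L2_mat[of A x] rep_L2_mat[of A y] rep_L2_mat[of A "x - y"] rep_L2_diff[of x y]
      rep_L2_diff[of "mat_L2 A x" "mat_L2 A y"]
    by eventually_elim (simp add: matrix_vector_mult_diff_distrib)
qed

lemma mat_L2_adjoint: "mat_L2 A x \<bullet> y = x \<bullet> mat_L2 (transpose A) y"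
proof -
  have [measurable]: "rep_L2 (mat_L2 A x) \<in> borel_measurable lebesgue"
    "rep_L2 (mat_L2 (transpose A) y) \<in> borel_measurable lebesgue"
    "rep_L2 x \<in> borel_measurable lebesgue" "rep_L2 y \<in> borel_measurable lebesgue"
    by simp_all
  show ?thesis unfolding inner_L2_eq
  proof (rule integral_cong_AE)
    show "AE t in lebesgue. rep_L2 (mat_L2 A x) t \<bullet> rep_L2 y t = rep_L2 x t \<bullet> rep_L2 (mat_L2 (transpose A) y) t"
      using rep_L2_mat[of A x] rep_L2_mat[of "transpose A" y]
      by eventually_elim (metis dot_lmul_matrix inner_commute transpose_matrix_vector)
  qed measurable
qed

lemma mat_L2_bounded: "\<exists>K>0. \<forall>x. norm (mat_L2 A x) \<le> K * norm x"
proof -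
  obtain K where K: "K > 0" "\<And>v. norm (A *v v) \<le> norm v * K"
    using bounded_linear.pos_bounded[OF matrix_vector_mul_bounded_linear[of A]] by auto
  have "norm (mat_L2 A x) \<le> K * norm x" for x
    by (rule norm_L2_le) (use rep_L2_mat[of A x] K in \<open>auto elim!: eventually_mono simp: mult.commute\<close>)
  then show ?thesis using K by auto
qed

section \<open>The projection onto the admissible controls\<close>

lemma convex_admissible_controls: "convex (admissible_controls tf ulo uhi)"
proof (rule convexI)
  fix u v :: "(real^'a) L2" and a b :: real
  assume uv: "u \<in> admissible_controls tf ulo uhi" "v \<in> admissible_controls tf ulo uhi"
    and ab: "0 \<le> a" "0 \<le> b" "a + b = 1"
  then have "AE t in lebesgue. t \<in> {0..tf} \<longrightarrow> (\<forall>i. ulo $ i \<le> rep_L2 u t $ i \<and> rep_L2 u t $ i \<le> uhi $ i)"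
    "AE t in lebesgue. t \<in> {0..tf} \<longrightarrow> (\<forall>i. ulo $ i \<le> rep_L2 v t $ i \<and> rep_L2 v t $ i \<le> uhi $ i)"
    by (auto simp: admissible_controls_def)
  with rep_L2_add[of "a *\<^sub>R u" "b *\<^sub>R v"] rep_L2_scaleR[of a u] rep_L2_scaleR[of b v]
  have "AE t in lebesgue. t \<in> {0..tf} \<longrightarrow>
      (\<forall>i. ulo $ i \<le> rep_L2 (a *\<^sub>R u + b *\<^sub>R v) t $ i \<and> rep_L2 (a *\<^sub>R u + b *\<^sub>R v) t $ i \<le> uhi $ i)"
  proof eventually_elim
    case (elim t)
    show ?case
    proof (intro impI allI)
      fix i assume "t \<in> {0..tf}"
      with elim have "rep_L2 u t $ i \<in> {ulo $ i..uhi $ i}" "rep_L2 v t $ i \<in> {ulo $ i..uhi $ i}" by auto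
      then have "a *\<^sub>R (rep_L2 u t $ i) + b *\<^sub>R (rep_L2 v t $ i) \<in> {ulo $ i..uhi $ i}"
        using ab by (intro convexD[OF convex_real_interval(5)])
      then show "ulo $ i \<le> rep_L2 (a *\<^sub>R u + b *\<^sub>R v) t $ i \<and> rep_L2 (a *\<^sub>R u + b *\<^sub>R v) t $ i \<le> uhi $ i"
        using elim by simp
    qed
  qed
  moreover have "a *\<^sub>R u + b *\<^sub>R v \<in> L2_on {0..tf}"
    using uv by (intro subspace_add[OF subspace_L2_on] subspace_scale[OF subspace_L2_on])
      (auto simp: admissible_controls_def)
  ultimately show "a *\<^sub>R u + b *\<^sub>R v \<in> admissible_controls tf ulo uhi"
    by (simp add: admissible_controls_def)
qed

text \<open>\<open>L2\<close> is not known to be complete here, but the closest point is the pointwise truncation.\<close>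

lemma admissible_controls_closest:
  fixes u :: "(real^'m) L2"
  assumes u: "u \<in> L2_on {0..tf}" and bounds: "\<And>i. ulo $ i < 0 \<and> 0 < uhi $ i"
  shows "\<exists>x\<in>admissible_controls tf ulo uhi. \<forall>y\<in>admissible_controls tf ulo uhi. dist u x \<le> dist u y"
proof -
  have b: "ulo $ i \<le> 0" "0 \<le> uhi $ i" "ulo $ i \<le> uhi $ i" for i using bounds[of i] by auto
  define c :: "real^'m \<Rightarrow> real^'m" where "c v = (\<chi> i. max (ulo $ i) (min (uhi $ i) (v $ i)))" for v
  have [measurable]: "c \<in> borel_measurable borel"
    unfolding c_def by (intro borel_measurable_continuous_onI continuous_intros)
  \<comment> \<open>The box contains 0, so truncation shrinks every coordinate. This gives square
    integrability and \<open>c 0 = 0\<close>, hence preserves vanishing outside the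
    interval.\<close>
  have c_norm: "norm (c v) \<le> norm v" for v
    unfolding norm_vec_def
  proof (rule L2_set_mono)
    fix i show "norm (c v $ i) \<le> norm (v $ i)"
      using bounds[of i] by (auto simp: c_def max_def min_def)
  qed simp
  \<comment> \<open>Coordinatewise truncation is the Euclidean projection onto a box; the pointwise
    inequality then integrates to the one in \<open>L2\<close>.\<close>
  have c_dist: "norm (v - c v) \<le> norm (v - w)" if "\<And>i. ulo $ i \<le> w $ i \<and> w $ i \<le> uhi $ i" for v w
    unfolding norm_vec_def
  proof (rule L2_set_mono)
    fix i show "norm ((v - c v) $ i) \<le> norm ((v - w) $ i)"
      using that[of i] by (auto simp: c_def max_def min_def)
  qed simp
  define x where "x = abs_L2 (\<lambda>t. c (rep_L2 u t))"
  have "square_integrable (\<lambda>t. c (rep_L2 u t))"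
    unfolding square_integrable_def
  proof
    show "(\<lambda>t. c (rep_L2 u t)) \<in> borel_measurable lebesgue" by measurable
    show "integrable lebesgue (\<lambda>t. (norm (c (rep_L2 u t)))\<^sup>2)"
      by (rule Bochner_Integration.integrable_bound[OF integrable_norm_rep_L2_power2[of u]])
        (auto intro!: power_mono c_norm)
  qed
  then have x: "AE t in lebesgue. rep_L2 x t = c (rep_L2 u t)"
    unfolding x_def by (rule rep_L2_abs_L2)
  have c0: "c 0 = 0" using c_norm[of 0] by simp
  have uL: "AE t in lebesgue. t \<notin> {0..tf} \<longrightarrow> rep_L2 u t = 0" using u by (simp add: L2_on_def)
  with x have "AE t in lebesgue. t \<notin> {0..tf} \<longrightarrow> rep_L2 x t = 0"
    by eventually_elim (simp add: c0)
  moreover from x have "AE t in lebesgue. t \<in> {0..tf} \<longrightarrow>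
      (\<forall>i. ulo $ i \<le> rep_L2 x t $ i \<and> rep_L2 x t $ i \<le> uhi $ i)"
    by eventually_elim (use b in \<open>auto simp: c_def\<close>)
  ultimately have "x \<in> admissible_controls tf ulo uhi"
    by (simp add: admissible_controls_def L2_on_def)
  moreover have "dist u x \<le> dist u y" if y: "y \<in> admissible_controls tf ulo uhi" for y
  proof -
    have "AE t in lebesgue. t \<notin> {0..tf} \<longrightarrow> rep_L2 y t = 0"
      and "AE t in lebesgue. t \<in> {0..tf} \<longrightarrow> (\<forall>i. ulo $ i \<le> rep_L2 y t $ i \<and> rep_L2 y t $ i \<le> uhi $ i)"
      using y by (auto simp: admissible_controls_def L2_on_def)
    with x uL rep_L2_diff[of u x] rep_L2_diff[of u y]
    have "AE t in lebesgue. norm (rep_L2 (u - x) t) \<le> 1 * norm (rep_L2 (u - y) t)"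
      by eventually_elim (auto simp: c0 b intro!: c_dist)
    then show ?thesis using norm_L2_le[of "u - x" 1 "u - y"] by (simp add: dist_norm)
  qed
  ultimately show ?thesis by blast
qed

section \<open>Weak derivatives\<close>

text \<open>The sets over which \<open>g\<close> integrates to zero form a Dynkin system containing
  the intersection-stable generator of open intervals, hence all Borel sets. Lebesgue sets differ
  from these by null sets, and each coordinate is then determined by its integrals.\<close>

lemma AE_zero_if_interval_integrals_zero:
  fixes g :: "real \<Rightarrow> 'a::euclidean_space"
  assumes g: "integrable lebesgue g" and total: "(LINT t|lebesgue. g t) = 0"
    and int: "\<And>a b. (LINT t:{a<..<b}|lebesgue. g t) = 0"
  shows "AE t in lebesgue. g t = 0"
proof -
  have set_int: "set_integrable lebesgue A g" if "A \<in> sets lebesgue" for A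
    unfolding set_integrable_def using integrable_mult_indicator[OF that g] .
  have borel: "(LINT t:A|lebesgue. g t) = 0" if "A \<in> sets borel" for A
  proof -
    have sets_eq: "sigma_sets UNIV (range (\<lambda>(a, b). {a<..<b::real})) = sets borel"
      by (simp add: borel_eq_box[where 'a = real] box_real case_prod_unfold)
    have "Int_stable (range (\<lambda>(a, b). {a<..<b::real}))"
    proof (rule Int_stableI)
      fix a b assume "a \<in> range (\<lambda>(a, b). {a<..<b::real})" "b \<in> range (\<lambda>(a, b). {a<..<b::real})"
      then obtain p q r s where "a = {p<..<q}" "b = {r<..<s}" by auto
      then have "a \<inter> b = (\<lambda>(a, b). {a<..<b}) (max p r, min q s)" by auto
      then show "a \<inter> b \<in> range (\<lambda>(a, b). {a<..<b::real})" by blast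
    qed
    then show ?thesis using subset_UNIV[of "range (\<lambda>(a, b). {a<..<b::real})", folded Pow_UNIV] that
      unfolding sets_eq[symmetric]
    proof (induction rule: sigma_sets_induct_disjoint)
      \<comment> \<open>The whole line is not one of the bounded intervals, so its integral is
        supplied by \<open>total\<close>.\<close>
      case (compl A)
      then have A: "A \<in> sets lebesgue" unfolding sets_eq by (auto intro: sets_completionI_sets)
      have "(LINT t:UNIV|lebesgue. g t) = (LINT t:A \<union> (UNIV - A)|lebesgue. g t)" by simp
      also have "\<dots> = (LINT t:A|lebesgue. g t) + (LINT t:UNIV - A|lebesgue. g t)"
        using A by (intro set_integral_Un set_int) auto
      finally show ?case using compl.IH total by (simp add: set_lebesgue_integral_def)
    next
      case (union A)
      have A: "A i \<in> sets lebesgue" for i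
        using union(2) unfolding sets_eq by (auto intro: sets_completionI_sets)
      have "(LINT t:(\<Union>i. A i)|lebesgue. g t) = (\<Sum>i. (LINT t:A i|lebesgue. g t))"
        using A union(1) by (intro lebesgue_integral_countable_add set_int) (auto simp: disjoint_family_on_def)
      then show ?case using union by simp
    qed (use int in \<open>auto simp: set_lebesgue_integral_def\<close>)
  qed
  have lebesgue: "(LINT t:A|lebesgue. g t) = 0" if A: "A \<in> sets lebesgue" for A
  proof -
    obtain S N N' where S: "A = S \<union> N" "N \<subseteq> N'" "N' \<in> null_sets lborel" "S \<in> sets lborel"
    using A by (rule sets_completionE)
  have "N' \<in> null_sets lebesgue" using S(3) by (rule null_sets_completionI)
  then have "AE t in lebesgue. t \<notin> N'" by (rule AE_not_in)
  then have "(LINT t:A|lebesgue. g t) = (LINT t:S|lebesgue. g t)"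
    using S set_int[OF A] set_int[of S]
    by (intro set_integral_cong_set)
      (auto elim!: eventually_mono simp: set_borel_measurable_def set_integrable_def
        intro: borel_measurable_integrable sets_completionI_sets)
  then show ?thesis using borel S by simp
  qed
  have "AE t in lebesgue. \<forall>i\<in>Basis. g t \<bullet> i = 0"
  proof (rule AE_finite_allI[OF finite_Basis])
    fix i :: 'a
    have gi: "integrable lebesgue (\<lambda>t. g t \<bullet> i)" using g by simp
    show "AE t in lebesgue. g t \<bullet> i = 0"
    proof (rule density_unique_real[OF gi])
      fix A :: "real set" assume A: "A \<in> sets lebesgue"
      have "(LINT t:A|lebesgue. g t \<bullet> i) = (LINT t:A|lebesgue. g t) \<bullet> i"
        using integral_inner_left[OF set_int[OF A, unfolded set_integrable_def], of i]
        by (simp add: set_lebesgue_integral_def)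
      then show "(LINT t:A|lebesgue. g t \<bullet> i) = (LINT t:A|lebesgue. 0)"
        using lebesgue[OF A] by (simp add: set_lebesgue_integral_def)
    qed simp
  qed
  then show ?thesis by eventually_elim (simp add: euclidean_eq_iff[where 'a = 'a])
qed

section \<open>Test functions and the fundamental lemma of the calculus of variations\<close>

lemma set_integrable_square_integrable:
  assumes f: "square_integrable f" and S: "S \<in> sets lebesgue" "emeasure lebesgue S < \<infinity>"
  shows "set_integrable lebesgue S f"
proof -
  have [measurable]: "f \<in> borel_measurable lebesgue" "S \<in> sets lebesgue"
    using f S by (auto simp: square_integrable_def)
  have bound: "norm (f t) \<le> 1 + (norm (f t))\<^sup>2" for t
    using sum_squares_bound[of 1 "norm (f t)"] norm_ge_zero[of "f t"] by (simp del: norm_ge_zero)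
  show ?thesis unfolding set_integrable_def
  proof (rule Bochner_Integration.integrable_bound)
    show "integrable lebesgue (\<lambda>t. indicat_real S t + (norm (f t))\<^sup>2)"
      using f S by (auto simp: square_integrable_def)
    show "AE t in lebesgue. norm (indicat_real S t *\<^sub>R f t) \<le> norm (indicat_real S t + (norm (f t))\<^sup>2)"
      using bound by (auto simp: indicator_def)
  qed measurable
qed

text \<open>Squaring removes the kink of the positive part, so a truncated polynomial becomes a C1
  test function.\<close>

lemma DERIV_max_0_power2: "((\<lambda>x::real. (max 0 x)\<^sup>2) has_real_derivative 2 * max 0 x) (at x)"
proof (cases x "0::real" rule: linorder_cases)
  case less
  have "((\<lambda>x. 0) has_real_derivative 2 * max 0 x) (at x)" using less by simp
  then show ?thesis
    by (rule has_field_derivative_transform_within_open[of _ _ _ "{..<0}"])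
      (use less in \<open>auto simp: max_def\<close>)
next
  case equal
  have "((\<lambda>y::real. max 0 y) \<longlongrightarrow> max 0 0) (at 0)" by (intro tendsto_intros)
  then have "((\<lambda>y::real. ((max 0 y)\<^sup>2 - (max 0 0)\<^sup>2) / (y - 0)) \<longlongrightarrow> max 0 0) (at 0)"
    by (rule Lim_transform_within[where d = 1]) (auto simp: max_def power2_eq_square)
  then show ?thesis using equal by (simp add: has_field_derivative_iff)
next
  case greater
  have "((\<lambda>x. x\<^sup>2) has_real_derivative 2 * max 0 x) (at x)"
    using greater by (auto intro!: derivative_eq_intros)
  then show ?thesis
    by (rule has_field_derivative_transform_within_open[of _ _ _ "{0<..}"])
      (use greater in \<open>auto simp: max_def\<close>)
qed

text \<open>No mollifier is involved: if \<open>q\<close> is a C1 bump with values in (0,1] on the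
  interval and 0 elsewhere, then \<open>1 - (1 - q t) ^ n\<close> tends to 1 exactly where
  \<open>q\<close> is positive.\<close>

lemma test_functions_approximate_indicator:
  assumes ab: "0 < a" "a < b" "b < tf"
  shows "\<exists>\<phi>. (\<forall>n. test_function tf (\<phi> n)) \<and> (\<forall>n t. 0 \<le> \<phi> n t \<and> \<phi> n t \<le> 1) \<and>
    (\<forall>t. (\<lambda>n. \<phi> n t) \<longlonglongrightarrow> indicat_real {a<..<b} t)"
proof -
  define r where "r t = (t - a) * (b - t)" for t
  \<comment> \<open>Since \<open>r t \<le> (b - a)\<^sup>2\<close>, dividing by \<open>C\<close>
    keeps \<open>q\<close> below 1.\<close>
  define C where "C = ((b - a)\<^sup>2)\<^sup>2"
  define q where "q t = (max 0 (r t))\<^sup>2 / C" for t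
  define q' where "q' t = 2 * max 0 (r t) * (a + b - 2 * t) / C" for t
  define \<phi> where "\<phi> n t = 1 - (1 - q t) ^ n" for n :: nat and t
  have C: "C > 0" using ab by (simp add: C_def)
  have r_le: "r t \<le> (b - a)\<^sup>2" for t
  proof -
    have "4 * r t = (b - a)\<^sup>2 - (2 * t - a - b)\<^sup>2" by (simp add: r_def power2_eq_square algebra_simps)
    also have "\<dots> \<le> 4 * (b - a)\<^sup>2"
      using zero_le_power2[of "2 * t - a - b"] zero_le_power2[of "b - a"] by linarith
    finally show ?thesis by simp
  qed
  have q01: "0 \<le> q t" "q t \<le> 1" for t
    using power_mono[of "max 0 (r t)" "(b - a)\<^sup>2" 2] r_le[of t] C
    by (auto simp: q_def C_def divide_simps)
  have r_pos: "r t > 0 \<longleftrightarrow> t \<in> {a<..<b}" for t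
    using ab by (auto simp: r_def zero_less_mult_iff)
  have q_pos: "t \<in> {a<..<b} \<Longrightarrow> q t > 0" for t
    using r_pos[of t] C by (simp add: q_def)
  have q_0: "t \<notin> {a<..<b} \<Longrightarrow> q t = 0" for t
    using r_pos[of t] by (auto simp: q_def max_def not_less order.antisym)
  have q_deriv: "(q has_real_derivative q' t) (at t)" for t
  proof -
    have "(r has_real_derivative (a + b - 2 * t)) (at t)"
      unfolding r_def by (auto intro!: derivative_eq_intros)
    from DERIV_chain2[OF DERIV_max_0_power2 this] show ?thesis
      unfolding q_def q'_def by (intro DERIV_cdivide) auto
  qed
  have \<phi>_deriv: "(\<phi> n has_real_derivative real n * (1 - q t) ^ (n - 1) * q' t) (at t)" for n t
    unfolding \<phi>_def by (auto intro!: derivative_eq_intros q_deriv)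
  have "test_function tf (\<phi> n)" for n
    unfolding test_function_def
  proof (intro conjI allI)
    show "\<phi> n differentiable at t" for t
      using \<phi>_deriv real_differentiable_def by blast
    have "deriv (\<phi> n) = (\<lambda>t. real n * (1 - q t) ^ (n - 1) * q' t)"
      using \<phi>_deriv DERIV_imp_deriv by blast
    moreover have "continuous_on UNIV (\<lambda>t. real n * (1 - q t) ^ (n - 1) * q' t)"
      using C unfolding q_def q'_def r_def by (intro continuous_intros) auto
    ultimately show "continuous_on UNIV (deriv (\<phi> n))" by simp
    show "\<exists>a b. 0 < a \<and> b < tf \<and> (\<forall>t. t \<notin> {a..b} \<longrightarrow> \<phi> n t = 0)"
      by (intro exI[of _ a] exI[of _ b]) (use ab q_0 in \<open>auto simp: \<phi>_def\<close>)
  qed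
  moreover have "0 \<le> \<phi> n t \<and> \<phi> n t \<le> 1" for n t
    using q01[of t] by (simp add: \<phi>_def power_le_one)
  moreover have "(\<lambda>n. \<phi> n t) \<longlonglongrightarrow> indicat_real {a<..<b} t" for t
  proof (cases "t \<in> {a<..<b}")
    case True
    then have "(\<lambda>n. (1 - q t) ^ n) \<longlonglongrightarrow> 0"
      using q_pos[of t] q01[of t] by (intro LIMSEQ_power_zero) auto
    then have "(\<lambda>n. 1 - (1 - q t) ^ n) \<longlonglongrightarrow> 1 - 0"
      by (rule tendsto_diff[OF tendsto_const])
    then show ?thesis using True by (simp add: \<phi>_def)
  qed (use q_0 in \<open>simp add: \<phi>_def\<close>)
  ultimately show ?thesis by blast
qed

text \<open>Dominated convergence replaces the test functions by indicators of intervals strictly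
  inside the domain, and a function whose integrals over all of these vanish is zero almost
  everywhere.\<close>

lemma fundamental_lemma_variations:
  fixes f :: "real \<Rightarrow> 'a::euclidean_space"
  assumes f: "square_integrable f"
    and test: "\<And>\<phi>. test_function tf \<phi> \<Longrightarrow> (LINT t:{0..tf}|lebesgue. \<phi> t *\<^sub>R f t) = 0"
  shows "AE t in lebesgue. t \<in> {0<..<tf} \<longrightarrow> f t = 0"
proof -
  have [measurable]: "f \<in> borel_measurable lebesgue" using f by (simp add: square_integrable_def)
  have interval: "(LINT t:{a<..<b}|lebesgue. f t) = 0" if ab: "0 < a" "b < tf" for a b
  proof (cases "a < b")
    case True
    obtain \<phi> where \<phi>: "\<And>n. test_function tf (\<phi> n)" "\<And>n t. 0 \<le> \<phi> n t \<and> \<phi> n t \<le> 1"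
      "\<And>t. (\<lambda>n. \<phi> n t) \<longlonglongrightarrow> indicat_real {a<..<b} t"
      using test_functions_approximate_indicator[OF ab(1) True ab(2)] by blast
    have [measurable]: "\<phi> n \<in> borel_measurable lebesgue" for n
    proof -
      have "continuous_on UNIV (\<phi> n)"
        using \<phi>(1)[of n] unfolding test_function_def
        by (meson continuous_at_imp_continuous_on differentiable_imp_continuous_within)
      then have "\<phi> n \<in> borel_measurable borel" by (rule borel_measurable_continuous_onI)
      then show ?thesis by (metis measurable_completion measurable_lborel2)
    qed
    have "(\<lambda>n. LINT t|lebesgue. indicat_real {0..tf} t *\<^sub>R (\<phi> n t *\<^sub>R f t))
        \<longlonglongrightarrow> (LINT t|lebesgue. indicat_real {0..tf} t *\<^sub>R (indicat_real {a<..<b} t *\<^sub>R f t))"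
    proof (rule integral_dominated_convergence)
      have "set_integrable lebesgue {0..tf} f"
        by (rule set_integrable_square_integrable[OF f]) (auto simp: emeasure_lborel_Icc_eq)
      then show "integrable lebesgue (\<lambda>t. norm (indicat_real {0..tf} t *\<^sub>R f t))"
        unfolding set_integrable_def by (rule integrable_norm)
      show "AE t in lebesgue. (\<lambda>n. indicat_real {0..tf} t *\<^sub>R (\<phi> n t *\<^sub>R f t))
         \<longlonglongrightarrow> indicat_real {0..tf} t *\<^sub>R (indicat_real {a<..<b} t *\<^sub>R f t)"
        by (intro AE_I2 tendsto_intros \<phi>(3))
      show "AE t in lebesgue. norm (indicat_real {0..tf} t *\<^sub>R (\<phi> n t *\<^sub>R f t))
          \<le> norm (indicat_real {0..tf} t *\<^sub>R f t)" for n
        using \<phi>(2)[of n] by (auto intro!: AE_I2 mult_left_le_one_le simp: indicator_def)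
    qed (auto intro!: borel_measurable_scaleR borel_measurable_times borel_measurable_indicator)
    moreover have "(\<lambda>t. indicat_real {0..tf} t *\<^sub>R (indicat_real {a<..<b} t *\<^sub>R f t))
        = (\<lambda>t. indicat_real {a<..<b} t *\<^sub>R f t)"
      using ab by (auto simp: indicator_def)
    moreover have "(LINT t|lebesgue. indicat_real {0..tf} t *\<^sub>R (\<phi> n t *\<^sub>R f t)) = 0" for n
      using test[OF \<phi>(1)[of n]] by (simp add: set_lebesgue_integral_def)
    ultimately show ?thesis
      by (simp add: set_lebesgue_integral_def LIMSEQ_const_iff)
  qed (auto simp: set_lebesgue_integral_def)
  \<comment> \<open>Test functions see only compact parts of the open interval; the margin
    \<open>e\<close> is removed afterwards along \<open>1 / real (Suc n)\<close>.\<close>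
  have inner: "AE t in lebesgue. t \<in> {e<..<tf - e} \<longrightarrow> f t = 0" if e: "e > 0" for e
  proof -
    define g where "g t = indicat_real {e<..<tf - e} t *\<^sub>R f t" for t
    have "AE t in lebesgue. g t = 0"
    proof (rule AE_zero_if_interval_integrals_zero)
      show "integrable lebesgue g"
        using set_integrable_square_integrable[OF f, of "{e<..<tf - e}"]
          emeasure_bounded_finite[of "{e<..<tf - e}"]
        by (simp add: set_integrable_def g_def[abs_def])
      show "(LINT t|lebesgue. g t) = 0"
        using interval[of e "tf - e"] e by (simp add: g_def set_lebesgue_integral_def)
      fix a b
      have "(LINT t:{a<..<b}|lebesgue. g t) = (LINT t:{max a e<..<min b (tf - e)}|lebesgue. f t)"
        unfolding set_lebesgue_integral_def g_def
        by (intro Bochner_Integration.integral_cong) (auto simp: indicator_def)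
      then show "(LINT t:{a<..<b}|lebesgue. g t) = 0"
        using interval[of "max a e" "min b (tf - e)"] e by simp
    qed
    then show ?thesis by eventually_elim (auto simp: g_def)
  qed
  have "AE t in lebesgue. \<forall>n. t \<in> {1 / real (Suc n)<..<tf - 1 / real (Suc n)} \<longrightarrow> f t = 0"
    unfolding AE_all_countable by (intro allI inner) simp
  then show ?thesis
  proof eventually_elim
    case (elim t)
    show ?case
    proof
      assume "t \<in> {0<..<tf}"
      then obtain n where "inverse (real (Suc n)) < min t (tf - t)"
        using reals_Archimedean[of "min t (tf - t)"] by auto
      then have "t \<in> {1 / real (Suc n)<..<tf - 1 / real (Suc n)}" by (auto simp: inverse_eq_divide)
      with elim show "f t = 0" by blast
    qed
  qed
qed

lemma absolutely_integrable_continuous_scaleR: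
  fixes g :: "real \<Rightarrow> 'a::euclidean_space"
  assumes \<phi>: "continuous_on {a..b} \<phi>" and g: "g absolutely_integrable_on {a..b}"
  shows "(\<lambda>t. \<phi> t *\<^sub>R g t) absolutely_integrable_on {a..b}"
proof -
  have "bounded (\<phi> ` {a..b})" by (intro compact_imp_bounded compact_continuous_image \<phi>) auto
  then obtain K where K: "\<And>t. t \<in> {a..b} \<Longrightarrow> norm (\<phi> t) \<le> K" unfolding bounded_iff by blast
  have "(\<lambda>t. indicat_real {a..b} t * \<phi> t) \<in> borel_measurable lebesgue"
    using absolutely_integrable_continuous_real[OF \<phi>]
    unfolding set_integrable_def by (auto dest: borel_measurable_integrable)
  moreover have "(\<lambda>t. indicat_real {a..b} t *\<^sub>R g t) \<in> borel_measurable lebesgue"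
    using g unfolding set_integrable_def by (rule borel_measurable_integrable)
  ultimately have "(\<lambda>t. (indicat_real {a..b} t * \<phi> t) *\<^sub>R (indicat_real {a..b} t *\<^sub>R g t)) \<in> borel_measurable lebesgue"
    by (rule borel_measurable_scaleR)
  also have "(\<lambda>t. (indicat_real {a..b} t * \<phi> t) *\<^sub>R (indicat_real {a..b} t *\<^sub>R g t))
      = (\<lambda>t. indicat_real {a..b} t *\<^sub>R (\<phi> t *\<^sub>R g t))" by (auto simp: indicator_def)
  finally have meas: "(\<lambda>t. indicat_real {a..b} t *\<^sub>R (\<phi> t *\<^sub>R g t)) \<in> borel_measurable lebesgue" .
  have "integrable lebesgue (\<lambda>t. K *\<^sub>R (indicat_real {a..b} t *\<^sub>R g t))"
    using g unfolding set_integrable_def by (rule integrable_scaleR_right)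
  then show ?thesis unfolding set_integrable_def
    by (rule Bochner_Integration.integrable_bound[OF _ meas])
      (use order_trans[OF K abs_ge_self] in \<open>auto intro!: AE_I2 mult_right_mono simp: indicator_def\<close>)
qed

lemma integral_cong_AE_lebesgue:
  fixes f g :: "real \<Rightarrow> 'a::euclidean_space"
  assumes "AE t in lebesgue. t \<in> S \<longrightarrow> f t = g t"
  shows "integral S f = integral S g"
proof -
  obtain N where "negligible N" "{t. \<not> (t \<in> S \<longrightarrow> f t = g t)} \<subseteq> N"
    using assms unfolding eventually_ae_filter_negligible by auto
  then show ?thesis by (intro integral_spike[of N]) auto
qed

text \<open>Uniqueness has three sources: the fundamental lemma inside the open interval, nullity of
  the endpoints, and vanishing of both candidates outside.\<close>

lemma weak_deriv_eqI:
  assumes y: "y \<in> L2_on {0..tf}" "has_weak_deriv tf x y"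
  shows "weak_deriv tf x = y"
  unfolding weak_deriv_def
proof (rule the_equality)
  show "y \<in> L2_on {0..tf} \<and> has_weak_deriv tf x y" using y by simp
  fix z assume z: "z \<in> L2_on {0..tf} \<and> has_weak_deriv tf x z"
  have "AE t in lebesgue. t \<in> {0<..<tf} \<longrightarrow> rep_L2 z t - rep_L2 y t = 0"
  proof (rule fundamental_lemma_variations)
    show "square_integrable (\<lambda>t. rep_L2 z t - rep_L2 y t)"
      by (intro square_integrable_diff square_integrable_rep_L2)
    fix \<phi> assume \<phi>: "test_function tf \<phi>"
    have \<phi>c: "continuous_on UNIV \<phi>"
      using \<phi> unfolding test_function_def
      by (meson continuous_at_imp_continuous_on differentiable_imp_continuous_within)
    have int: "set_integrable lebesgue {0..tf} (\<lambda>t. \<phi> t *\<^sub>R rep_L2 u t)" for u :: "'a L2"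
      by (intro absolutely_integrable_continuous_scaleR continuous_on_subset[OF \<phi>c]
          set_integrable_square_integrable square_integrable_rep_L2) (auto simp: emeasure_lborel_Icc_eq)
    have "(LINT t:{0..tf}|lebesgue. \<phi> t *\<^sub>R (rep_L2 z t - rep_L2 y t))
      = (LINT t:{0..tf}|lebesgue. \<phi> t *\<^sub>R rep_L2 z t) - (LINT t:{0..tf}|lebesgue. \<phi> t *\<^sub>R rep_L2 y t)"
      unfolding scaleR_diff_right by (rule set_integral_diff(2)[OF int int])
    also have "\<dots> = 0" using y(2) z \<phi> by (simp add: has_weak_deriv_def)
    finally show "(LINT t:{0..tf}|lebesgue. \<phi> t *\<^sub>R (rep_L2 z t - rep_L2 y t)) = 0" .
  qed
  moreover have "AE t in lebesgue. t \<noteq> 0" "AE t in lebesgue. t \<noteq> tf"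
    by (auto intro!: AE_completion AE_lborel_singleton)
  moreover have "AE t in lebesgue. t \<notin> {0..tf} \<longrightarrow> rep_L2 y t = 0"
    "AE t in lebesgue. t \<notin> {0..tf} \<longrightarrow> rep_L2 z t = 0"
    using y z by (auto simp: L2_on_def)
  ultimately have "AE t in lebesgue. rep_L2 z t = rep_L2 y t"
    by eventually_elim (auto simp: not_le)
  then show "z = y" by (rule L2_eqI)
qed

text \<open>Two continuous functions equal almost everywhere have a distance with zero integral,
  hence agree everywhere, endpoints included. On an interval of positive length this pins down
  whatever the choice operator returns.\<close>

lemma cont_rep_eqI:
  fixes x :: "'a::euclidean_space L2"
  assumes f: "continuous_on {0..tf} f" and ae: "AE t in lebesgue. t \<in> {0..tf} \<longrightarrow> rep_L2 x t = f t"
    and tf: "tf > 0" and t: "t \<in> {0..tf}"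
  shows "cont_rep tf x t = f t"
proof -
  let ?c = "cont_rep tf x"
  have c: "continuous_on {0..tf} ?c \<and> (AE t in lebesgue. t \<in> {0..tf} \<longrightarrow> rep_L2 x t = ?c t)"
    unfolding cont_rep_def by (rule someI[of _ f]) (use f ae in auto)
  define h where "h t = norm (?c t - f t)" for t
  have h: "continuous_on {0..tf} h" unfolding h_def using c f by (intro continuous_intros) auto
  from c have "AE t in lebesgue. t \<in> {0..tf} \<longrightarrow> rep_L2 x t = ?c t" by simp
  with ae have "AE t in lebesgue. t \<in> {0..tf} \<longrightarrow> h t = 0"
    by eventually_elim (auto simp: h_def)
  then have "integral {0..tf} h = integral {0..tf} (\<lambda>_. 0)" by (rule integral_cong_AE_lebesgue)
  then have "integral {0..tf} h = 0" by simp
  moreover have "integral {0..tf} h = 0 \<longleftrightarrow> (\<forall>t\<in>{0..tf}. h t = 0)"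
    by (rule integral_eq_0_iff[OF h tf]) (simp add: h_def)
  ultimately have "h t = 0" using t by blast
  then show ?thesis by (simp add: h_def)
qed

section \<open>Integration by parts and weak derivatives of indefinite integrals\<close>

text \<open>Over a partition into equal steps \<open>h\<close> the bounds telescope in
  \<open>G\<close> to \<open>K * h * (G b - G a)\<close>, which tends to zero. This avoids
  differentiating an indefinite Lebesgue integral almost everywhere.\<close>

lemma eq_endpoints_if_superlinear_increments:
  fixes \<Psi> :: "real \<Rightarrow> 'a::real_normed_vector" and G :: "real \<Rightarrow> real"
  assumes ab: "a \<le> b"
    and inc: "\<And>s t. a \<le> s \<Longrightarrow> s \<le> t \<Longrightarrow> t \<le> b \<Longrightarrow> norm (\<Psi> t - \<Psi> s) \<le> K * (t - s) * (G t - G s)"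
  shows "\<Psi> b = \<Psi> a"
proof -
  have bound: "norm (\<Psi> b - \<Psi> a) \<le> (K * (b - a) * (G b - G a)) / real (Suc N)" for N
  proof -
    define h where "h = (b - a) / real (Suc N)"
    have h: "h \<ge> 0" using ab by (simp add: h_def)
    have hN: "real (Suc N) * h = b - a" by (simp add: h_def)
    have "norm (\<Psi> (a + real k * h) - \<Psi> a) \<le> K * h * (G (a + real k * h) - G a)" if "k \<le> Suc N" for k
      using that
    proof (induction k)
      case (Suc k)
      have "real (Suc k) * h \<le> real (Suc N) * h" using Suc.prems h by (intro mult_right_mono) auto
      then have "norm (\<Psi> (a + real (Suc k) * h) - \<Psi> (a + real k * h))
          \<le> K * ((a + real (Suc k) * h) - (a + real k * h)) * (G (a + real (Suc k) * h) - G (a + real k * h))"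
        using h hN by (intro inc) (auto simp: algebra_simps)
      also have "(a + real (Suc k) * h) - (a + real k * h) = h" by (simp add: algebra_simps)
      finally have "norm (\<Psi> (a + real (Suc k) * h) - \<Psi> a)
          \<le> K * h * (G (a + real (Suc k) * h) - G (a + real k * h)) + K * h * (G (a + real k * h) - G a)"
        using Suc by (intro norm_diff_triangle_le) auto
      then show ?case by (simp add: algebra_simps)
    qed simp
    from this[of "Suc N"] have "norm (\<Psi> b - \<Psi> a) \<le> K * h * (G b - G a)"
      unfolding hN by simp
    then show ?thesis by (simp add: h_def)
  qed
  have "(\<lambda>N. (K * (b - a) * (G b - G a)) / real (Suc N)) \<longlonglongrightarrow> 0"
    using LIMSEQ_Suc[OF lim_const_over_n] by simp
  then have "norm (\<Psi> b - \<Psi> a) \<le> 0"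
    by (rule LIMSEQ_le_const) (use bound in auto)
  then show ?thesis by simp
qed

lemma integral_split_Icc:
  fixes f :: "real \<Rightarrow> 'a::banach"
  assumes "f integrable_on {a..b}" "a \<le> s" "s \<le> t" "t \<le> b"
  shows "integral {a..t} f = integral {a..s} f + integral {s..t} f"
proof -
  have "f integrable_on {a..t}"
    by (rule integrable_subinterval_real[OF assms(1)]) (use assms in auto)
  from Henstock_Kurzweil_Integration.integral_combine[OF assms(2,3) this] show ?thesis by simp
qed

text \<open>The function \<open>\<Psi>\<close> below is the defect in the integration by parts formula. It is constant because
  its increments are bounded by products of two increments.\<close>

lemma integration_by_parts_indefinite_integral:
  fixes g :: "real \<Rightarrow> 'a::euclidean_space"
  assumes ab: "a \<le> b"
    and \<phi>: "\<And>t. t \<in> {a..b} \<Longrightarrow> (\<phi> has_real_derivative \<phi>' t) (at t within {a..b})"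
    and \<phi>': "continuous_on {a..b} \<phi>'" and g: "g absolutely_integrable_on {a..b}"
  shows "integral {a..b} (\<lambda>t. \<phi>' t *\<^sub>R integral {a..t} g) + integral {a..b} (\<lambda>t. \<phi> t *\<^sub>R g t)
    = \<phi> b *\<^sub>R integral {a..b} g"
proof -
  define F where "F t = integral {a..t} g" for t
  define G where "G t = integral {a..t} (\<lambda>t. norm (g t))" for t
  define \<Psi> where "\<Psi> t = integral {a..t} (\<lambda>t. \<phi>' t *\<^sub>R F t) + integral {a..t} (\<lambda>t. \<phi> t *\<^sub>R g t) - \<phi> t *\<^sub>R F t" for t
  have gi: "g integrable_on {a..b}" "(\<lambda>t. norm (g t)) integrable_on {a..b}"
    using g by (auto simp: absolutely_integrable_on_def)
  have \<phi>c: "continuous_on {a..b} \<phi>" using \<phi> by (rule DERIV_continuous_on)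
  have F: "continuous_on {a..b} F" unfolding F_def by (rule indefinite_integral_continuous_1[OF gi(1)])
  have "bounded (\<phi>' ` {a..b})" by (intro compact_imp_bounded compact_continuous_image \<phi>') auto
  then obtain K where K: "\<And>t. t \<in> {a..b} \<Longrightarrow> norm (\<phi>' t) \<le> K" unfolding bounded_iff by blast
  have K0: "K \<ge> 0" using K[of a] ab order_trans[OF norm_ge_zero] by auto
  have I1: "(\<lambda>t. \<phi>' t *\<^sub>R F t) integrable_on {a..b}"
    by (intro integrable_continuous_interval continuous_intros \<phi>' F)
  have I2: "(\<lambda>t. \<phi> t *\<^sub>R g t) integrable_on {a..b}"
    using absolutely_integrable_continuous_scaleR[OF \<phi>c g] by (simp add: absolutely_integrable_on_def)
  have "\<Psi> b = \<Psi> a"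
  proof (rule eq_endpoints_if_superlinear_increments[OF ab, of \<Psi> "2 * K" G])
    fix s t assume st: "a \<le> s" "s \<le> t" "t \<le> b"
    have st': "{s..t} \<subseteq> {a..b}" using st by auto
    note sub' = integrable_subinterval_real[OF _ st']
    have F_diff: "F v - F u = integral {u..v} g" if "s \<le> u" "u \<le> v" "v \<le> t" for u v
      using integral_split_Icc[OF gi(1), of u v] st that by (simp add: F_def)
    have G_diff: "G v - G u = integral {u..v} (\<lambda>t. norm (g t))" if "s \<le> u" "u \<le> v" "v \<le> t" for u v
      using integral_split_Icc[OF gi(2), of u v] st that by (simp add: G_def)
    have F_le: "norm (F t - F r) \<le> G t - G s" if "s \<le> r" "r \<le> t" for r
    proof -
      have "norm (F t - F r) \<le> G t - G r"
        unfolding F_diff[OF that order_refl] G_diff[OF that order_refl] using that st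
        by (intro integral_norm_bound_integral integrable_subinterval_real[OF gi(1)] integrable_subinterval_real[OF gi(2)]) auto
      also have "\<dots> \<le> G t - G s"
        using G_diff[OF order_refl that] integral_nonneg[OF integrable_subinterval_real[OF gi(2)], of s r] st that by auto
      finally show ?thesis .
    qed
    have \<phi>_le: "norm (\<phi> r - \<phi> s) \<le> K * (t - s)" if "s \<le> r" "r \<le> t" for r
    proof -
      have "norm (\<phi> r - \<phi> s) \<le> K * norm (r - s)"
        by (rule field_differentiable_bound[of "{a..b}" _ \<phi>']) (use \<phi> K st that in auto)
      also have "\<dots> \<le> K * (t - s)" using that K0 by (intro mult_left_mono) auto
      finally show ?thesis .
    qed
    have "((\<phi>') has_integral (\<phi> t - \<phi> s)) {s..t}"
      using st by (intro fundamental_theorem_of_calculus)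
        (auto simp flip: has_real_derivative_iff_has_vector_derivative intro: DERIV_subset[OF \<phi>])
    then have 0: "((\<lambda>r. \<phi>' r *\<^sub>R F t) has_integral (\<phi> t - \<phi> s) *\<^sub>R F t) {s..t}"
      by (rule has_integral_scaleR_left)
    have 1: "integral {s..t} (\<lambda>r. \<phi>' r *\<^sub>R (F r - F t)) = integral {s..t} (\<lambda>r. \<phi>' r *\<^sub>R F r) - (\<phi> t - \<phi> s) *\<^sub>R F t"
      unfolding scaleR_diff_right using 0
      by (subst Henstock_Kurzweil_Integration.integral_diff) (auto intro: sub' I1 simp: integral_unique)
    have 2: "integral {s..t} (\<lambda>r. (\<phi> r - \<phi> s) *\<^sub>R g r) = integral {s..t} (\<lambda>r. \<phi> r *\<^sub>R g r) - \<phi> s *\<^sub>R (F t - F s)"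
      unfolding scaleR_diff_left F_diff[OF order_refl st(2) order_refl]
      by (subst Henstock_Kurzweil_Integration.integral_diff) (auto intro!: sub' I2 integrable_cmul gi)
    have 3: "\<Psi> t - \<Psi> s = integral {s..t} (\<lambda>r. \<phi>' r *\<^sub>R (F r - F t)) + integral {s..t} (\<lambda>r. (\<phi> r - \<phi> s) *\<^sub>R g r)"
      unfolding 1 2 \<Psi>_def integral_split_Icc[OF I1 st] integral_split_Icc[OF I2 st] by (simp add: algebra_simps)
    have "norm (integral {s..t} (\<lambda>r. \<phi>' r *\<^sub>R (F r - F t))) \<le> integral {s..t} (\<lambda>r. K * (G t - G s))"
    proof (rule integral_norm_bound_integral)
      show "(\<lambda>r. \<phi>' r *\<^sub>R (F r - F t)) integrable_on {s..t}"
        using st by (intro integrable_continuous_interval continuous_intros continuous_on_subset[OF \<phi>'] continuous_on_subset[OF F]) auto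
      fix r assume "r \<in> {s..t}"
      then show "norm (\<phi>' r *\<^sub>R (F r - F t)) \<le> K * (G t - G s)"
        using K[of r] F_le[of r] st K0 by (auto simp: norm_minus_commute intro!: mult_mono)
    qed (rule integrable_const_ivl)
    moreover have "norm (integral {s..t} (\<lambda>r. (\<phi> r - \<phi> s) *\<^sub>R g r)) \<le> integral {s..t} (\<lambda>r. K * (t - s) * norm (g r))"
    proof (rule integral_norm_bound_integral)
      show "(\<lambda>r. (\<phi> r - \<phi> s) *\<^sub>R g r) integrable_on {s..t}"
        unfolding scaleR_diff_left by (intro Henstock_Kurzweil_Integration.integrable_diff sub' I2 integrable_cmul gi)
      show "(\<lambda>r. K * (t - s) * norm (g r)) integrable_on {s..t}"
        by (intro integrable_on_mult_right sub' gi)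
      fix r assume "r \<in> {s..t}"
      then show "norm ((\<phi> r - \<phi> s) *\<^sub>R g r) \<le> K * (t - s) * norm (g r)"
        using \<phi>_le[of r] by (auto intro!: mult_right_mono)
    qed
    moreover have "integral {s..t} (\<lambda>r. K * (t - s) * norm (g r)) = K * (t - s) * (G t - G s)"
      using G_diff[OF order_refl st(2) order_refl] by simp
    ultimately show "norm (\<Psi> t - \<Psi> s) \<le> 2 * K * (t - s) * (G t - G s)"
      unfolding 3 using st by (intro order_trans[OF norm_triangle_ineq]) (simp add: algebra_simps)
  qed
  then show ?thesis by (simp add: \<Psi>_def F_def)
qed

definition L2_restrict :: "real set \<Rightarrow> (real \<Rightarrow> 'a::euclidean_space) \<Rightarrow> 'a L2" where
  "L2_restrict S f = abs_L2 (\<lambda>t. indicat_real S t *\<^sub>R f t)"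

lemma rep_L2_restrict:
  assumes "square_integrable (\<lambda>t. indicat_real S t *\<^sub>R f t)"
  shows "AE t in lebesgue. rep_L2 (L2_restrict S f) t = indicat_real S t *\<^sub>R f t"
  unfolding L2_restrict_def by (rule rep_L2_abs_L2[OF assms])

lemma L2_restrict_in_L2_on:
  assumes "square_integrable (\<lambda>t. indicat_real S t *\<^sub>R f t)"
  shows "L2_restrict S f \<in> L2_on S"
  using rep_L2_restrict[OF assms] unfolding L2_on_def mem_Collect_eq
  by eventually_elim auto

lemma square_integrable_continuous_Icc:
  assumes "continuous_on {a..b} f"
  shows "square_integrable (\<lambda>t. indicat_real {a..b} t *\<^sub>R f t)"
proof -
  have "(\<lambda>t. (norm (f t))\<^sup>2) absolutely_integrable_on {a..b}"
    using assms by (intro absolutely_integrable_continuous_real continuous_intros)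
  moreover have "(\<lambda>t. (norm (indicat_real {a..b} t *\<^sub>R f t))\<^sup>2) = (\<lambda>t. indicat_real {a..b} t *\<^sub>R (norm (f t))\<^sup>2)"
    by (auto simp: indicator_def)
  moreover have "f absolutely_integrable_on {a..b}" using assms by (rule absolutely_integrable_continuous_real)
  ultimately show ?thesis
    unfolding square_integrable_def set_integrable_def by (auto dest: borel_measurable_integrable)
qed

text \<open>A test function vanishes at both endpoints, which kills the contribution of
  \<open>c\<close> and the boundary term of the integration by parts.\<close>

lemma has_weak_deriv_indefinite_integral:
  fixes x y :: "'a::euclidean_space L2"
  assumes tf: "tf > 0"
    and x: "AE t in lebesgue. t \<in> {0..tf} \<longrightarrow> rep_L2 x t = c + integral {0..t} (rep_L2 y)"
  shows "has_weak_deriv tf x y"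
  unfolding has_weak_deriv_def
proof (intro allI impI)
  fix \<phi> assume "test_function tf \<phi>"
  then obtain a b where diff: "\<And>t. \<phi> differentiable at t" and cont: "continuous_on UNIV (deriv \<phi>)"
    and ab: "0 < a" "b < tf" "\<And>t. t \<notin> {a..b} \<Longrightarrow> \<phi> t = 0"
    unfolding test_function_def by auto
  have \<phi>0: "\<phi> 0 = 0" "\<phi> tf = 0" using ab tf by auto
  have D: "(\<phi> has_real_derivative deriv \<phi> t) (at t within S)" for t S
    using diff DERIV_deriv_iff_real_differentiable has_field_derivative_at_within by blast
  have \<phi>c: "continuous_on S \<phi>" for S using D by (rule DERIV_continuous_on)
  have \<phi>'c: "continuous_on S (deriv \<phi>)" for S using cont by (rule continuous_on_subset) auto
  let ?F = "\<lambda>t. integral {0..t} (rep_L2 y)"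
  have yi: "rep_L2 y absolutely_integrable_on {0..tf}"
    by (rule set_integrable_square_integrable[OF square_integrable_rep_L2]) (auto simp: emeasure_lborel_Icc_eq)
  have xi: "rep_L2 x absolutely_integrable_on {0..tf}"
    by (rule set_integrable_square_integrable[OF square_integrable_rep_L2]) (auto simp: emeasure_lborel_Icc_eq)
  have F: "continuous_on {0..tf} ?F"
    using yi by (intro indefinite_integral_continuous_1) (simp add: absolutely_integrable_on_def)
  have xi': "(\<lambda>t. deriv \<phi> t *\<^sub>R rep_L2 x t) absolutely_integrable_on {0..tf}"
    by (rule absolutely_integrable_continuous_scaleR[OF \<phi>'c xi])
  have Fi: "(\<lambda>t. deriv \<phi> t *\<^sub>R (c + ?F t)) absolutely_integrable_on {0..tf}"
    by (intro absolutely_integrable_continuous_real continuous_intros \<phi>'c F)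
  have "(LINT t:{0..tf}|lebesgue. deriv \<phi> t *\<^sub>R rep_L2 x t) = (LINT t:{0..tf}|lebesgue. deriv \<phi> t *\<^sub>R (c + ?F t))"
    unfolding set_lebesgue_integral_def
  proof (rule integral_cong_AE)
    show "(\<lambda>t. indicat_real {0..tf} t *\<^sub>R (deriv \<phi> t *\<^sub>R rep_L2 x t)) \<in> borel_measurable lebesgue"
      "(\<lambda>t. indicat_real {0..tf} t *\<^sub>R (deriv \<phi> t *\<^sub>R (c + ?F t))) \<in> borel_measurable lebesgue"
      using xi' Fi unfolding set_integrable_def by (auto dest: borel_measurable_integrable)
    show "AE t in lebesgue. indicat_real {0..tf} t *\<^sub>R (deriv \<phi> t *\<^sub>R rep_L2 x t)
        = indicat_real {0..tf} t *\<^sub>R (deriv \<phi> t *\<^sub>R (c + ?F t))"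
      using x by eventually_elim (auto simp: indicator_def)
  qed
  also have "\<dots> = integral {0..tf} (\<lambda>t. deriv \<phi> t *\<^sub>R (c + ?F t))"
    by (rule set_lebesgue_integral_eq_integral(2)[OF Fi])
  also have "\<dots> = integral {0..tf} (\<lambda>t. deriv \<phi> t *\<^sub>R c) + integral {0..tf} (\<lambda>t. deriv \<phi> t *\<^sub>R ?F t)"
    unfolding scaleR_add_right
    by (intro Henstock_Kurzweil_Integration.integral_add integrable_continuous_interval continuous_intros \<phi>'c F)
  also have "integral {0..tf} (\<lambda>t. deriv \<phi> t *\<^sub>R c) = (\<phi> tf - \<phi> 0) *\<^sub>R c"
    using tf by (intro integral_unique has_integral_scaleR_left fundamental_theorem_of_calculus)
      (auto simp flip: has_real_derivative_iff_has_vector_derivative intro: D)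
  also have "integral {0..tf} (\<lambda>t. deriv \<phi> t *\<^sub>R ?F t) = - integral {0..tf} (\<lambda>t. \<phi> t *\<^sub>R rep_L2 y t)"
    using integration_by_parts_indefinite_integral[OF _ D \<phi>'c yi] tf \<phi>0 by (simp add: eq_neg_iff_add_eq_0)
  also have "integral {0..tf} (\<lambda>t. \<phi> t *\<^sub>R rep_L2 y t) = (LINT t:{0..tf}|lebesgue. \<phi> t *\<^sub>R rep_L2 y t)"
    by (rule set_lebesgue_integral_eq_integral(2)[symmetric, OF absolutely_integrable_continuous_scaleR[OF \<phi>c yi]])
  finally show "(LINT t:{0..tf}|lebesgue. deriv \<phi> t *\<^sub>R rep_L2 x t) = - (LINT t:{0..tf}|lebesgue. \<phi> t *\<^sub>R rep_L2 y t)"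
    using \<phi>0 by simp
qed

section \<open>Inversion of the state and adjoint operators\<close>

text \<open>Existence is by contraction in the norm weighted by \<open>exp (- 2 K t)\<close>, where \<open>K\<close> bounds \<open>A\<close>.\<close>

lemma linear_volterra_solution:
  fixes A :: "'a::euclidean_space \<Rightarrow> 'a" and tf :: real
  assumes A: "bounded_linear A" and tf: "tf \<ge> 0"
  shows "\<exists>C>0. \<forall>h H. continuous_on {0..tf} h \<longrightarrow> (\<forall>t\<in>{0..tf}. norm (h t) \<le> H) \<longrightarrow>
    (\<exists>x. continuous_on {0..tf} x \<and> (\<forall>t\<in>{0..tf}. x t = h t + integral {0..t} (\<lambda>s. A (x s)))
      \<and> (\<forall>t\<in>{0..tf}. norm (x t) \<le> C * H))"
proof -
  interpret A: bounded_linear A by (rule A)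
  obtain K where K: "K > 0" "\<And>v. norm (A v) \<le> norm v * K" using A.pos_bounded by auto
  \<comment> \<open>Integrating the weight yields the factor \<open>K / \<beta> = 1/2\<close>, which
    serves both as contraction constant and in the a priori bound.\<close>
  define \<beta> where "\<beta> = 2 * K"
  have \<beta>: "\<beta> > 0" using K by (simp add: \<beta>_def)
  have int_bound: "norm (exp (- \<beta> * t) *\<^sub>R integral {0..t} (\<lambda>s. exp (\<beta> * s) *\<^sub>R A (u s))) \<le> M / 2"
    if u: "continuous_on UNIV u" and M: "\<And>s. norm (u s) \<le> M" and t: "t \<ge> 0" for u t M
  proof -
    have "((\<lambda>s. K * M * exp (\<beta> * s)) has_integral (K * M * exp (\<beta> * t) / \<beta> - K * M * exp (\<beta> * 0) / \<beta>)) {0..t}"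
      using \<beta> by (intro fundamental_theorem_of_calculus[OF t])
        (auto intro!: derivative_eq_intros simp flip: has_real_derivative_iff_has_vector_derivative)
    then have I: "(\<lambda>s. K * M * exp (\<beta> * s)) integrable_on {0..t}"
      "integral {0..t} (\<lambda>s. K * M * exp (\<beta> * s)) = K * M * exp (\<beta> * t) / \<beta> - K * M / \<beta>"
      by (simp_all only: has_integral_integrable integral_unique mult_zero_right exp_zero mult_1_right)
    have M0: "M \<ge> 0" using order_trans[OF norm_ge_zero M] .
    have "norm (integral {0..t} (\<lambda>s. exp (\<beta> * s) *\<^sub>R A (u s))) \<le> integral {0..t} (\<lambda>s. K * M * exp (\<beta> * s))"
    proof (rule integral_norm_bound_integral[OF _ I(1)])
      show "(\<lambda>s. exp (\<beta> * s) *\<^sub>R A (u s)) integrable_on {0..t}"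
        by (intro integrable_continuous_interval continuous_intros A.continuous_on continuous_on_subset[OF u]) auto
      fix s
      have "norm (A (u s)) \<le> K * M"
        using order_trans[OF K(2) mult_right_mono[OF M[of s]]] K(1) by (simp add: mult.commute)
      then show "norm (exp (\<beta> * s) *\<^sub>R A (u s)) \<le> K * M * exp (\<beta> * s)"
        by (simp add: mult.commute)
    qed
    also have "\<dots> \<le> K * M * exp (\<beta> * t) / \<beta>" using I(2) K M0 \<beta> by simp
    also have "\<dots> = M / 2 * exp (\<beta> * t)" using K by (simp add: \<beta>_def)
    finally show ?thesis by (simp add: exp_minus field_simps)
  qed
  have main: "\<exists>x. continuous_on {0..tf} x \<and> (\<forall>t\<in>{0..tf}. x t = h t + integral {0..t} (\<lambda>s. A (x s)))
      \<and> (\<forall>t\<in>{0..tf}. norm (x t) \<le> 2 * exp (\<beta> * tf) * H)"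
    if h: "continuous_on {0..tf} h" and H: "\<And>t. t \<in> {0..tf} \<Longrightarrow> norm (h t) \<le> H" for h H
  proof -
    \<comment> \<open>The Volterra operator conjugated by the weight, for the unknown
      \<open>y t = exp (- \<beta> * t) *\<^sub>R x t\<close>; the weighted norm becomes the sup
      norm.\<close>
    define P where "P y t = exp (- \<beta> * t) *\<^sub>R (h t + integral {0..t} (\<lambda>s. exp (\<beta> * s) *\<^sub>R A (apply_bcontfun y s)))"
      for y :: "real \<Rightarrow>\<^sub>C 'a" and t
    have int: "(\<lambda>s. exp (\<beta> * s) *\<^sub>R A (apply_bcontfun y s)) integrable_on {0..t}" for y t
      by (intro integrable_continuous_interval continuous_intros A.continuous_on) auto
    \<comment> \<open>Clamping the argument extends \<open>P y\<close> to the whole line, so the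
      iteration runs in the complete space of bounded continuous functions.\<close>
    have "\<exists>g :: real \<Rightarrow>\<^sub>C 'a. \<forall>t. apply_bcontfun g t = P y (clamp 0 tf t)" for y
    proof -
      have "continuous_on (cbox 0 tf) (P y)"
        unfolding P_def using h int by (auto intro!: continuous_intros indefinite_integral_continuous_1)
      then show ?thesis by (rule continuous_on_cbox_bcontfunE) auto
    qed
    then obtain \<Phi> :: "(real \<Rightarrow>\<^sub>C 'a) \<Rightarrow> (real \<Rightarrow>\<^sub>C 'a)" where \<Phi>: "\<And>y t. apply_bcontfun (\<Phi> y) t = P y (clamp 0 tf t)"
      by metis
    have clamp: "clamp 0 tf t \<in> {0..tf}" for t :: real
      using clamp_in_interval[of 0 tf t] tf by simp
    have contr: "dist (\<Phi> y) (\<Phi> z) \<le> 1/2 * dist y z" for y z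
    proof (rule dist_bound)
      fix t
      let ?t = "clamp 0 tf t"
      have "P y ?t - P z ?t = exp (- \<beta> * ?t) *\<^sub>R integral {0..?t} (\<lambda>s. exp (\<beta> * s) *\<^sub>R A (apply_bcontfun y s - apply_bcontfun z s))"
        unfolding P_def A.diff scaleR_diff_right[of "exp (\<beta> * _)"] integral_diff[OF int int]
        by (simp add: algebra_simps)
      also have "norm \<dots> \<le> dist y z / 2"
        using clamp[of t] by (intro int_bound continuous_intros) (auto simp: dist_norm[symmetric] dist_bounded)
      finally show "dist (apply_bcontfun (\<Phi> y) t) (apply_bcontfun (\<Phi> z) t) \<le> 1/2 * dist y z"
        by (simp add: \<Phi> dist_norm)
    qed
    then obtain y where y: "\<Phi> y = y"
      using banach_fix_type[of "1/2" \<Phi>] by auto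
    define x where "x t = exp (\<beta> * t) *\<^sub>R apply_bcontfun y t" for t
    have y_eq: "apply_bcontfun y t = P y t" if "t \<in> {0..tf}" for t
      using \<Phi>[of y t] y that by (metis clamp_cancel_cbox cbox_interval)
    \<comment> \<open>Absorbing the half gives \<open>2 * H\<close>; undoing the weight accounts for
      the constant \<open>2 * exp (\<beta> * tf)\<close>.\<close>
    have "norm y \<le> H + norm y / 2"
    proof (rule norm_bound)
      fix t
      let ?t = "clamp 0 tf t"
      have "norm (P y ?t) \<le> norm (exp (- \<beta> * ?t) *\<^sub>R h ?t)
          + norm (exp (- \<beta> * ?t) *\<^sub>R integral {0..?t} (\<lambda>s. exp (\<beta> * s) *\<^sub>R A (apply_bcontfun y s)))"
        unfolding P_def scaleR_add_right by (rule norm_triangle_ineq)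
      also have "\<dots> \<le> H + norm y / 2"
      proof (rule add_mono)
        have "norm (exp (- \<beta> * ?t) *\<^sub>R h ?t) \<le> 1 * norm (h ?t)"
          unfolding norm_scaleR using clamp[of t] \<beta> by (intro mult_right_mono) auto
        then show "norm (exp (- \<beta> * ?t) *\<^sub>R h ?t) \<le> H" using H[OF clamp[of t]] by simp
        show "norm (exp (- \<beta> * ?t) *\<^sub>R integral {0..?t} (\<lambda>s. exp (\<beta> * s) *\<^sub>R A (apply_bcontfun y s))) \<le> norm y / 2"
          using clamp[of t] by (intro int_bound norm_bounded continuous_on_apply_bcontfun) simp
      qed
      finally show "norm (apply_bcontfun y t) \<le> H + norm y / 2" using \<Phi>[of y t] y by simp
    qed
    then have ny: "norm y \<le> 2 * H" by simp
    show ?thesis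
    proof (intro exI[of _ x] conjI ballI)
      show "continuous_on {0..tf} x" unfolding x_def by (intro continuous_intros) auto
      fix t assume t: "t \<in> {0..tf}"
      have "x t = h t + integral {0..t} (\<lambda>s. exp (\<beta> * s) *\<^sub>R A (apply_bcontfun y s))"
        unfolding x_def y_eq[OF t] P_def by (simp flip: exp_add)
      then show "x t = h t + integral {0..t} (\<lambda>s. A (x s))" by (simp add: x_def A.scaleR)
      have "norm (x t) \<le> exp (\<beta> * tf) * (2 * H)"
        unfolding x_def norm_scaleR using t \<beta> ny norm_bounded[of y t]
        by (intro mult_mono) auto
      then show "norm (x t) \<le> 2 * exp (\<beta> * tf) * H" by simp
    qed
  qed
  show ?thesis by (rule exI[of _ "2 * exp (\<beta> * tf)"]) (use main in auto)
qed

section \<open>From integral equations to elements of H1\<close>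

lemma rep_L2_integrable_on: "rep_L2 y integrable_on {a..b}"
  using set_integrable_square_integrable[OF square_integrable_rep_L2[of y], of "{a..b}"]
  by (simp add: emeasure_lborel_Icc_eq absolutely_integrable_on_def)

lemma continuous_on_integral_rep_L2: "continuous_on {0..tf} (\<lambda>t. integral {0..t} (rep_L2 y))"
  by (rule indefinite_integral_continuous_1[OF rep_L2_integrable_on])

text \<open>The passage from classical solutions to the weak setting: a function in integrated form
  has the weak derivative and the point values read off from that form.\<close>

lemma L2_restrict_indefinite_integral:
  fixes y :: "'a::euclidean_space L2"
  assumes tf: "tf > 0" and y: "y \<in> L2_on {0..tf}"
    and X: "\<And>t. t \<in> {0..tf} \<Longrightarrow> X t = c + integral {0..t} (rep_L2 y)"
  shows "L2_restrict {0..tf} X \<in> H1 tf" "weak_deriv tf (L2_restrict {0..tf} X) = y"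
    "t \<in> {0..tf} \<Longrightarrow> cont_rep tf (L2_restrict {0..tf} X) t = X t"
proof -
  let ?x = "L2_restrict {0..tf} X"
  have Xc: "continuous_on {0..tf} X"
    using X by (subst continuous_on_cong[OF refl X]) (auto intro!: continuous_intros continuous_on_integral_rep_L2)
  note sq = square_integrable_continuous_Icc[OF Xc]
  have rep: "AE t in lebesgue. t \<in> {0..tf} \<longrightarrow> rep_L2 ?x t = X t"
    using rep_L2_restrict[OF sq] by eventually_elim auto
  then have "AE t in lebesgue. t \<in> {0..tf} \<longrightarrow> rep_L2 ?x t = c + integral {0..t} (rep_L2 y)"
    by eventually_elim (use X in auto)
  then have wd: "has_weak_deriv tf ?x y" by (rule has_weak_deriv_indefinite_integral[OF tf])
  then show "?x \<in> H1 tf" "weak_deriv tf ?x = y"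
    using y L2_restrict_in_L2_on[OF sq] weak_deriv_eqI[OF y wd] by (auto simp: H1_def)
  show "t \<in> {0..tf} \<Longrightarrow> cont_rep tf ?x t = X t"
    by (rule cont_rep_eqI[OF Xc rep tf])
qed

lemma L2_restrict_zero: "L2_restrict S (\<lambda>_. 0) = 0"
  by (simp add: L2_restrict_def zero_L2_def)

lemma zero_H1:
  assumes tf: "tf > 0"
  shows "(0 :: 'a::euclidean_space L2) \<in> H1 tf" "weak_deriv tf (0 :: 'a L2) = 0"
    "t \<in> {0..tf} \<Longrightarrow> cont_rep tf (0 :: 'a L2) t = 0"
proof -
  have "integral {0..t} (rep_L2 (0 :: 'a L2)) = integral {0..t} (\<lambda>_. 0)" for t
    by (rule integral_cong_AE_lebesgue) (use rep_L2_zero in \<open>auto elim: eventually_mono\<close>)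
  then have X: "0 = 0 + integral {0..t} (rep_L2 (0 :: 'a L2))" for t by simp
  show "(0 :: 'a L2) \<in> H1 tf" "weak_deriv tf (0 :: 'a L2) = 0" "t \<in> {0..tf} \<Longrightarrow> cont_rep tf (0 :: 'a L2) t = 0"
    using L2_restrict_indefinite_integral[OF tf subspace_0[OF subspace_L2_on] X] 
    unfolding L2_restrict_zero by auto
qed

lemma mat_L2_zero [simp]: "mat_L2 A 0 = 0"
  using mat_L2_diff[of A 0 0] by simp

lemma A_op_zero: "tf > 0 \<Longrightarrow> A_op tf A 0 = 0"
  by (simp add: A_op_def zero_H1 zero_prod_def)

lemma A_adj_zero: "tf > 0 \<Longrightarrow> A_adj tf A 0 = 0"
  by (simp add: A_adj_def zero_H1)

lemma zero_A_adj_dom: "tf > 0 \<Longrightarrow> 0 \<in> A_adj_dom tf"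
  by (simp add: A_adj_dom_def zero_H1 zero_prod_def)

lemma norm_L2_restrict_le:
  assumes X: "continuous_on {0..tf} X" and M: "\<And>t. t \<in> {0..tf} \<Longrightarrow> norm (X t) \<le> M" and tf: "tf > 0"
  shows "norm (L2_restrict {0..tf} X) \<le> sqrt tf * M"
proof -
  have M0: "M \<ge> 0" using order_trans[OF norm_ge_zero M[of 0]] tf by simp
  have "(norm (L2_restrict {0..tf} X))\<^sup>2 \<le> (LINT t|lebesgue. indicat_real {0..tf} t * M\<^sup>2)"
    unfolding norm_L2_power2
  proof (rule integral_mono_AE[OF integrable_norm_rep_L2_power2])
    show "AE t in lebesgue. (norm (rep_L2 (L2_restrict {0..tf} X) t))\<^sup>2 \<le> indicat_real {0..tf} t * M\<^sup>2"
      using rep_L2_restrict[OF square_integrable_continuous_Icc[OF X]]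
      by eventually_elim (auto simp: indicator_def intro!: power_mono M)
  qed (auto simp: emeasure_lborel_Icc_eq)
  also have "\<dots> = (sqrt tf * M)\<^sup>2" using tf by (simp add: power_mult_distrib)
  finally show ?thesis by (rule power2_le_imp_le) (use M0 tf in auto)
qed

text \<open>Young's inequality with weight \<open>N\<close> bounds the integrand by
  \<open>N / 2\<close> plus a multiple of its square; the two parts integrate to at most
  \<open>tf * (N / 2)\<close> and \<open>N / 2\<close>. The weight has to be positive, so it is a
  bound on the norm and not the norm itself.\<close>

lemma norm_integral_rep_L2_le:
  assumes N: "norm y \<le> N" "N > 0" and t: "t \<in> {0..tf}"
  shows "norm (integral {0..t} (rep_L2 y)) \<le> (tf + 1) / 2 * N"
proof -
  have si: "(\<lambda>s. (norm (rep_L2 y s))\<^sup>2) absolutely_integrable_on {0..t}"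
    unfolding set_integrable_def
    by (rule integrable_mult_indicator[OF _ integrable_norm_rep_L2_power2]) auto
  have "(LINT s:{0..t}|lebesgue. (norm (rep_L2 y s))\<^sup>2) \<le> (norm y)\<^sup>2"
    unfolding norm_L2_power2 set_lebesgue_integral_def
    by (rule integral_mono[OF si[unfolded set_integrable_def] integrable_norm_rep_L2_power2])
      (auto simp: indicator_def)
  then have I: "integral {0..t} (\<lambda>s. (norm (rep_L2 y s))\<^sup>2) \<le> N\<^sup>2"
    using set_lebesgue_integral_eq_integral(2)[OF si] power_mono[OF N(1) norm_ge_zero, of 2] by simp
  have sii: "(\<lambda>s. (norm (rep_L2 y s))\<^sup>2) integrable_on {0..t}"
    using si by (simp add: absolutely_integrable_on_def)
  have "norm (integral {0..t} (rep_L2 y)) \<le> integral {0..t} (\<lambda>s. N / 2 + 1 / (2 * N) * (norm (rep_L2 y s))\<^sup>2)"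
  proof (rule integral_norm_bound_integral[OF rep_L2_integrable_on])
    show "(\<lambda>s. N / 2 + 1 / (2 * N) * (norm (rep_L2 y s))\<^sup>2) integrable_on {0..t}"
      by (intro Henstock_Kurzweil_Integration.integrable_add integrable_on_mult_right sii integrable_const_ivl)
    show "norm (rep_L2 y s) \<le> N / 2 + 1 / (2 * N) * (norm (rep_L2 y s))\<^sup>2" for s
      using sum_squares_bound[of N "norm (rep_L2 y s)"] N(2)
      by (simp add: field_simps power2_eq_square)
  qed
  also have "\<dots> = integral {0..t} (\<lambda>s. N / 2) + 1 / (2 * N) * integral {0..t} (\<lambda>s. (norm (rep_L2 y s))\<^sup>2)"
    by (simp only: Henstock_Kurzweil_Integration.integral_add[OF integrable_const_ivl integrable_on_mult_right[OF sii]]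
        Henstock_Kurzweil_Integration.integral_mult_right)
  also have "integral {0..t} (\<lambda>s. N / 2) = t * (N / 2)" using t by simp
  also have "t * (N / 2) \<le> tf * (N / 2)" using t N by (intro mult_right_mono) auto
  also have "1 / (2 * N) * integral {0..t} (\<lambda>s. (norm (rep_L2 y s))\<^sup>2) \<le> 1 / (2 * N) * N\<^sup>2"
    using I N by (intro mult_left_mono) auto
  also have "1 / (2 * N) * N\<^sup>2 = N / 2" using N by (simp add: power2_eq_square)
  finally show ?thesis by (simp add: algebra_simps)
qed

text \<open>For \<open>p = (f, c)\<close> the integrated form of \<open>x' - A x = f\<close>,
  \<open>x(0) = c\<close> is a Volterra equation. The constant combines the bounds on its data and
  solution with the passage from the sup norm to the norm of \<open>L2\<close>.\<close>

lemma A_op_right_inverse: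
  fixes A :: "real^'n::finite^'n"
  assumes tf: "tf > 0"
  shows "\<exists>C>0. \<forall>p\<in>Z_space tf. \<exists>x\<in>H1 tf. A_op tf A x = p \<and> norm x \<le> C * norm p"
proof -
  obtain C where C: "C > 0" and volterra: "\<And>h H. continuous_on {0..tf} h \<Longrightarrow>
      (\<And>t. t\<in>{0..tf} \<Longrightarrow> norm (h t) \<le> H) \<Longrightarrow>
      \<exists>x. continuous_on {0..tf} x \<and> (\<forall>t\<in>{0..tf}. x t = h t + integral {0..t} (\<lambda>s. A *v x s))
      \<and> (\<forall>t\<in>{0..tf}. norm (x t) \<le> C * H)"
    using linear_volterra_solution[OF matrix_vector_mul_bounded_linear[of A], of tf] tf by auto
  define C' where "C' = sqrt tf * (C * (1 + (tf + 1) / 2))"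
  have C': "C' > 0" using tf C by (simp add: C'_def add_pos_pos)
  have "\<exists>x\<in>H1 tf. A_op tf A x = p \<and> norm x \<le> C' * norm p" if p: "p \<in> Z_space tf" for p
  \<comment> \<open>The bound on the data divides by \<open>norm p\<close>.\<close>
  proof (cases "p = 0")
    case True
    then show ?thesis using zero_H1(1)[OF tf] A_op_zero[OF tf] by (intro bexI[of _ 0]) auto
  next
    case False
    obtain f c where pfc: "p = (f, c)" by (cases p)
    have f: "f \<in> L2_on {0..tf}" using p by (simp add: pfc Z_space_def)
    define N where "N = norm p"
    have N: "N > 0" "norm f \<le> N" "norm c \<le> N"
      using False norm_fst_le[of f c] norm_snd_le[of c f] by (simp_all add: N_def pfc)
    define h where "h t = c + integral {0..t} (rep_L2 f)" for t
    have h: "continuous_on {0..tf} h"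
      unfolding h_def by (intro continuous_intros continuous_on_integral_rep_L2)
    have "norm (h t) \<le> (1 + (tf + 1) / 2) * N" if "t \<in> {0..tf}" for t
      using norm_triangle_ineq[of c "integral {0..t} (rep_L2 f)"] N(3)
        norm_integral_rep_L2_le[OF N(2,1) that] unfolding h_def distrib_right by linarith
    from volterra[OF h this] obtain X where X: "continuous_on {0..tf} X"
      "\<And>t. t \<in> {0..tf} \<Longrightarrow> X t = h t + integral {0..t} (\<lambda>s. A *v X s)"
      "\<And>t. t \<in> {0..tf} \<Longrightarrow> norm (X t) \<le> C * ((1 + (tf + 1) / 2) * N)" by blast
    define x where "x = L2_restrict {0..tf} X"
    have xL: "x \<in> L2_on {0..tf}"
      unfolding x_def by (intro L2_restrict_in_L2_on square_integrable_continuous_Icc X)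
    \<comment> \<open>The weak derivative dictated by the equation; the Volterra equation says that
      \<open>X\<close> is its indefinite integral.\<close>
    define y where "y = f + mat_L2 A x"
    have y: "y \<in> L2_on {0..tf}"
      unfolding y_def by (intro subspace_add[OF subspace_L2_on] f mat_L2_in_L2_on xL)
    have rep_y: "AE t in lebesgue. t \<in> {0..tf} \<longrightarrow> rep_L2 y t = rep_L2 f t + A *v X t"
      using rep_L2_add[of f "mat_L2 A x"] rep_L2_mat[of A x]
        rep_L2_restrict[OF square_integrable_continuous_Icc[OF X(1)]]
      unfolding y_def x_def by eventually_elim auto
    have eq: "X t = c + integral {0..t} (rep_L2 y)" if t: "t \<in> {0..tf}" for t
    proof -
      have "integral {0..t} (rep_L2 y) = integral {0..t} (\<lambda>s. rep_L2 f s + A *v X s)"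
        by (rule integral_cong_AE_lebesgue) (use rep_y t in \<open>auto elim!: eventually_mono\<close>)
      also have "\<dots> = integral {0..t} (rep_L2 f) + integral {0..t} (\<lambda>s. A *v X s)"
        using t by (intro Henstock_Kurzweil_Integration.integral_add rep_L2_integrable_on integrable_continuous_interval
            bounded_linear.continuous_on[OF matrix_vector_mul_bounded_linear] continuous_on_subset[OF X(1)]) auto
      finally show ?thesis using X(2)[OF t] by (simp add: h_def)
    qed
    note H = L2_restrict_indefinite_integral[OF tf y eq, folded x_def]
    have "X 0 = c" using eq[of 0] tf by simp
    then have "A_op tf A x = p"
      using H(2) H(3)[of 0] tf by (simp add: A_op_def y_def pfc)
    moreover have "norm x \<le> C' * norm p"
      using norm_L2_restrict_le[OF X(1,3) tf] by (simp add: x_def C'_def N_def mult.assoc)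
    ultimately show ?thesis using H(1) by blast
  qed
  then show ?thesis using C' by blast
qed

text \<open>The adjoint equation carries its condition at the final time. The reversal
  \<open>m(s) = X(tf - s)\<close> turns it into a forward Volterra equation whose datum
  \<open>h s\<close> is the integral of \<open>f\<close> over the last stretch of length
  \<open>s\<close>.\<close>

lemma A_adj_surjective:
  fixes A :: "real^'n::finite^'n"
  assumes tf: "tf > 0" and f: "f \<in> L2_on {0..tf}"
  shows "\<exists>q\<in>A_adj_dom tf. A_adj tf A q = f"
proof -
  let ?A = "transpose A"
  let ?F = "\<lambda>t. integral {0..t} (rep_L2 f)"
  define h where "h s = ?F tf - ?F (tf - s)" for s
  have h: "continuous_on {0..tf} h"
    unfolding h_def
    by (intro continuous_intros continuous_on_compose2[OF continuous_on_integral_rep_L2]) auto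
  then have "bounded (h ` {0..tf})" by (intro compact_imp_bounded compact_continuous_image) auto
  then obtain H where "\<And>t. t \<in> {0..tf} \<Longrightarrow> norm (h t) \<le> H" unfolding bounded_iff by blast
  then obtain m where m: "continuous_on {0..tf} m"
    "\<And>t. t \<in> {0..tf} \<Longrightarrow> m t = h t + integral {0..t} (\<lambda>s. ?A *v m s)"
    using linear_volterra_solution[OF matrix_vector_mul_bounded_linear[of ?A], of tf] tf h by (metis less_imp_le)
  define X where "X t = m (tf - t)" for t
  have X: "continuous_on {0..tf} X"
    unfolding X_def by (intro continuous_on_compose2[OF m(1)] continuous_intros) auto
  have Am: "continuous_on {0..tf} (\<lambda>s. ?A *v m s)" and AX: "continuous_on {0..tf} (\<lambda>s. ?A *v X s)"
    by (rule bounded_linear.continuous_on[OF matrix_vector_mul_bounded_linear], fact)+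
  let ?P = "\<lambda>t. integral {0..t} (\<lambda>s. ?A *v m s)"
  \<comment> \<open>The time reversal is undone in the integral by differentiating
    \<open>?P (tf - s)\<close>, which is C1 because \<open>m\<close> is continuous.\<close>
  have P: "?P (tf - t) - ?P tf = - integral {0..t} (\<lambda>s. ?A *v X s)" if t: "t \<in> {0..tf}" for t
  proof -
    have "((\<lambda>s. - (?A *v X s)) has_integral (?P (tf - t) - ?P (tf - 0))) {0..t}"
    proof (rule fundamental_theorem_of_calculus)
      fix s assume s: "s \<in> {0..t}"
      have "((\<lambda>s. tf - s) has_vector_derivative -1) (at s within {0..t})"
        by (auto intro!: derivative_eq_intros simp flip: has_real_derivative_iff_has_vector_derivative)
      moreover have "(?P has_vector_derivative ?A *v m (tf - s)) (at (tf - s) within (\<lambda>s. tf - s) ` {0..t})"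
        by (rule has_vector_derivative_within_subset[OF integral_has_vector_derivative[OF Am]]) (use s t in auto)
      ultimately have "(?P \<circ> (\<lambda>s. tf - s) has_vector_derivative -1 *\<^sub>R (?A *v m (tf - s))) (at s within {0..t})"
        by (rule vector_diff_chain_within)
      then show "((\<lambda>s. ?P (tf - s)) has_vector_derivative - (?A *v X s)) (at s within {0..t})"
        by (simp add: o_def X_def)
    qed (use t in auto)
    then show ?thesis by (auto dest!: integral_unique)
  qed
  define x where "x = L2_restrict {0..tf} X"
  have xL: "x \<in> L2_on {0..tf}"
    unfolding x_def by (intro L2_restrict_in_L2_on square_integrable_continuous_Icc X)
  define y where "y = - f - mat_L2 ?A x"
  have y: "y \<in> L2_on {0..tf}"
    unfolding y_def by (intro subspace_diff[OF subspace_L2_on] subspace_neg[OF subspace_L2_on] f mat_L2_in_L2_on xL)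
  have rep_y: "AE t in lebesgue. t \<in> {0..tf} \<longrightarrow> rep_L2 y t = - (rep_L2 f t + ?A *v X t)"
    using rep_L2_diff[of "- f" "mat_L2 ?A x"] rep_L2_uminus[of f] rep_L2_mat[of ?A x]
      rep_L2_restrict[OF square_integrable_continuous_Icc[OF X]]
    unfolding y_def x_def by eventually_elim auto
  have eq: "X t = X 0 + integral {0..t} (rep_L2 y)" if t: "t \<in> {0..tf}" for t
  proof -
    have AXi: "(\<lambda>s. ?A *v X s) integrable_on {0..t}"
      using t by (intro integrable_continuous_interval continuous_on_subset[OF AX]) auto
    have "integral {0..t} (rep_L2 y) = integral {0..t} (\<lambda>s. - (rep_L2 f s + ?A *v X s))"
      by (rule integral_cong_AE_lebesgue) (use rep_y t in \<open>auto elim!: eventually_mono\<close>)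
    also have "\<dots> = - (?F t + integral {0..t} (\<lambda>s. ?A *v X s))"
      by (simp only: Henstock_Kurzweil_Integration.integral_neg
          Henstock_Kurzweil_Integration.integral_add[OF rep_L2_integrable_on AXi])
    also have "\<dots> = - ?F t + (?P (tf - t) - ?P tf)" unfolding P[OF t] by simp
    also have "\<dots> = X t - X 0"
    proof -
      have "X t = ?F tf - ?F t + ?P (tf - t)" "X 0 = ?F tf - ?F 0 + ?P tf"
        using m(2)[of "tf - t"] m(2)[of tf] t tf by (auto simp: X_def h_def)
      then show ?thesis by simp
    qed
    finally show ?thesis by simp
  qed
  note H = L2_restrict_indefinite_integral[OF tf y eq, folded x_def]
  have "X tf = 0" using m(2)[of 0] tf by (simp add: X_def h_def)
  then have "(x, X 0) \<in> A_adj_dom tf"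
    using H(1) H(3)[of 0] H(3)[of tf] tf by (simp add: A_adj_dom_def)
  moreover have "A_adj tf A (x, X 0) = f" using H(2) by (simp add: A_adj_def y_def)
  ultimately show ?thesis by blast
qed

section \<open>The stability theorem\<close>

theorem theorem4p2:
  fixes tf \<alpha> \<mu> L :: real
    and A :: "real^'n::finite^'n" and B :: "real^'m::finite^'n"
    and ulo uhi :: "real^'m"
    and l :: "real^'n \<Rightarrow> real"
    and gradJ :: "(real^'n) L2 \<Rightarrow> (real^'n) L2"
    and T :: "real \<Rightarrow> 'n primal_dual \<Rightarrow> 'n primal_dual"
    and x0 :: "real^'n" and wstar :: "'n primal_dual"
  assumes tf: "tf > 0" and \<alpha>: "\<alpha> > 0"
    and bounds: "\<And>i. ulo $ i < 0 \<and> 0 < uhi $ i"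
    and l_cont: "continuous_on UNIV l" and l_convex: "convex_on UNIV l"
    and l_nonneg: "\<And>v. l v \<ge> 0" and l_0: "l 0 = 0"
    and J_well_defined:
      "\<And>x. x \<in> L2_on {0..tf} \<Longrightarrow> set_integrable lebesgue {0..tf} (\<lambda>\<tau>. l (rep_L2 x \<tau>))"
    and gradJ_in: "\<And>x. x \<in> L2_on {0..tf} \<Longrightarrow> gradJ x \<in> L2_on {0..tf}"
    and gradJ: "\<And>x. x \<in> L2_on {0..tf} \<Longrightarrow>
      (state_cost tf l has_derivative (\<lambda>h. gradJ x \<bullet> h)) (at x within L2_on {0..tf})"
    and \<mu>: "\<mu> > 0" and L: "L > 0"
    and gradJ_bounds: "\<And>x y. x \<in> L2_on {0..tf} \<Longrightarrow> y \<in> L2_on {0..tf} \<Longrightarrow>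
      \<mu> * (norm (x - y))\<^sup>2 \<le> (gradJ x - gradJ y) \<bullet> (x - y) \<and>
      (gradJ x - gradJ y) \<bullet> (x - y) \<le> L * (norm (x - y))\<^sup>2"
    and T_group: "unitary_C0_group (W_space tf) T"
    and T_gen: "is_generator (W_space tf) T (J_dom tf) (J_op tf A)"
    and wstar_dom: "wstar \<in> J_dom tf"
    and wstar: "S_op tf A B \<alpha> ulo uhi gradJ wstar = (0, (0, x0))"
  shows "\<exists>M \<eta>. M \<ge> 1 \<and> \<eta> > 0 \<and>
    (\<forall>w0 \<in> W_space tf. \<forall>w.
       mild_solution (W_space tf) T (\<lambda>v. R_op tf B \<alpha> ulo uhi gradJ v + (0, (0, x0))) w0 w \<longrightarrow>
       (\<forall>t\<ge>0. norm (w t - wstar) \<le> M * exp (- \<eta> * t) * norm (w0 - wstar)))"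
proof -
  let ?X = "L2_on {0..tf} :: (real^'n) L2 set" and ?Z = "Z_space tf :: 'n adjst set"
  let ?U = "admissible_controls tf ulo uhi"
  define P where "P p = orth_proj ?U ((1/\<alpha>) *\<^sub>R B_adj B p)" for p :: "'n adjst"
  define R2 where "R2 p = B_op B (P p)" for p :: "'n adjst"
  have Z: "subspace ?Z"
    unfolding Z_space_def by (intro subspace_Times subspace_L2_on subspace_UNIV)
  obtain K where K: "K > 0" "\<And>x. norm (mat_L2 B x) \<le> K * norm x" using mat_L2_bounded[of B] by auto
  obtain K' where K': "K' > 0" "\<And>x. norm (mat_L2 (transpose B) x) \<le> K' * norm x"
    using mat_L2_bounded[of "transpose B"] by auto
  have closest: "\<exists>x\<in>?U. \<forall>y\<in>?U. dist ((1/\<alpha>) *\<^sub>R B_adj B p) x \<le> dist ((1/\<alpha>) *\<^sub>R B_adj B p) y" if "p \<in> ?Z" for p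
    using that
    by (intro admissible_controls_closest[OF _ bounds] subspace_scale[OF subspace_L2_on])
      (auto simp: B_adj_def Z_space_def intro: mat_L2_in_L2_on)
  have B_adj_diff: "B_adj B p - B_adj B q = mat_L2 (transpose B) (fst (p - q))" for p q :: "'n adjst"
    by (simp add: B_adj_def mat_L2_diff)
  have R2_diff: "R2 p - R2 q = (mat_L2 B (P p - P q), 0)" for p q
    by (simp add: R2_def B_op_def mat_L2_diff)
  have R2_in: "R2 p \<in> ?Z" if "p \<in> ?Z" for p
  proof -
    have "P p \<in> ?U"
      unfolding P_def by (rule orth_proj_variational(1)[OF convex_admissible_controls closest[OF that]])
    then show ?thesis
      by (auto simp: R2_def B_op_def Z_space_def admissible_controls_def intro: mat_L2_in_L2_on)
  qed
  \<comment> \<open>Moving \<open>mat_L2 B\<close> to the other side makes the arguments of the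
    projection appear up to the positive factor \<alpha>, so firm nonexpansiveness applies.\<close>
  have R2_mono: "0 \<le> (R2 p - R2 q) \<bullet> (p - q)" if pq: "p \<in> ?Z" "q \<in> ?Z" for p q
  proof -
    have "0 \<le> (norm (P p - P q))\<^sup>2" by simp
    also have "\<dots> \<le> (P p - P q) \<bullet> ((1/\<alpha>) *\<^sub>R B_adj B p - (1/\<alpha>) *\<^sub>R B_adj B q)"
      unfolding P_def
      by (rule orth_proj_firmly_nonexpansive[OF convex_admissible_controls closest[OF pq(1)] closest[OF pq(2)]])
    also have "\<dots> = (1/\<alpha>) * ((P p - P q) \<bullet> mat_L2 (transpose B) (fst (p - q)))"
      by (simp only: scaleR_diff_right[symmetric] B_adj_diff inner_scaleR_right)
    also have "(P p - P q) \<bullet> mat_L2 (transpose B) (fst (p - q)) = (R2 p - R2 q) \<bullet> (p - q)"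
      unfolding R2_diff inner_prod_def by (simp add: mat_L2_adjoint)
    finally show ?thesis using \<alpha> by (simp add: zero_le_mult_iff zero_le_divide_iff)
  qed
  have R2_lip: "norm (R2 p - R2 q) \<le> (K * K' / \<alpha>) * norm (p - q)" if pq: "p \<in> ?Z" "q \<in> ?Z" for p q
  proof -
    have "norm (R2 p - R2 q) \<le> K * norm (P p - P q)" unfolding R2_diff by (simp add: K)
    also have "norm (P p - P q) \<le> norm ((1/\<alpha>) *\<^sub>R B_adj B p - (1/\<alpha>) *\<^sub>R B_adj B q)"
      unfolding P_def
      by (rule orth_proj_nonexpansive[OF convex_admissible_controls closest[OF pq(1)] closest[OF pq(2)]])
    also have "\<dots> = (1/\<alpha>) * norm (mat_L2 (transpose B) (fst (p - q)))"
      using \<alpha> by (simp only: scaleR_diff_right[symmetric] B_adj_diff norm_scaleR) simp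
    also have "\<dots> \<le> (1/\<alpha>) * (K' * norm (p - q))"
    proof -
      have "norm (fst (p - q)) \<le> norm (p - q)" by (metis norm_fst_le prod.collapse)
      then show ?thesis
        using \<alpha> K'(1) by (intro mult_left_mono order_trans[OF K'(2)]) auto
    qed
    finally show ?thesis using K(1) by (simp add: mult_left_mono mult.assoc)
  qed
  define N where "N = max L (K * K' / \<alpha>)"
  have N: "N > 0" "L \<le> N" "K * K' / \<alpha> \<le> N" using L by (auto simp: N_def)
  obtain C where C: "C > 0" and "\<forall>p\<in>?Z. \<exists>x\<in>H1 tf. A_op tf A x = p \<and> norm x \<le> C * norm p"
    using A_op_right_inverse[OF tf, of A] by auto
  \<comment> \<open>A pointwise choice; additivity is derived in the abstract theorem.\<close>
  then obtain G where G: "\<And>p. p \<in> ?Z \<Longrightarrow> G p \<in> H1 tf \<and> A_op tf A (G p) = p \<and> norm (G p) \<le> C * norm p"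
    by metis
  have W: "W_space tf = ?X \<times> ?Z" by (simp add: W_space_def)
  have R: "(\<lambda>v. R_op tf B \<alpha> ulo uhi gradJ v + (0, (0, x0))) = (\<lambda>w. (gradJ (fst w), R2 (snd w)) + (0, (0, x0)))"
    by (simp add: R_op_def R2_def P_def)
  have "\<exists>\<eta>>0. \<forall>w0 \<in> ?X \<times> ?Z. \<forall>w.
      mild_solution (?X \<times> ?Z) T (\<lambda>w. (gradJ (fst w), R2 (snd w)) + (0, (0, x0))) w0 w \<longrightarrow>
      (\<forall>t\<ge>0. norm (w t - wstar) \<le> 2 * exp (- \<eta> * t) * norm (w0 - wstar))"
  proof (rule primal_dual_exponentially_stable[OF subspace_L2_on Z])
    show "(0, (0, x0)) \<in> ?X \<times> ?Z" by (simp add: Z_space_def subspace_0[OF subspace_L2_on])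
    show "unitary_C0_group (?X \<times> ?Z) T" "is_generator (?X \<times> ?Z) T (J_dom tf) (J_op tf A)"
      using T_group T_gen by (simp_all add: W)
    show "(G p, 0) \<in> J_dom tf \<and> J_op tf A (G p, 0) = (0, p) \<and> norm (G p) \<le> C * norm p" if "p \<in> ?Z" for p
      using G[OF that] by (simp add: J_dom_def J_op_def zero_A_adj_dom[OF tf] A_adj_zero[OF tf])
    show "\<exists>q. (0, q) \<in> J_dom tf \<and> J_op tf A (0, q) = (- f, 0)" if "f \<in> ?X" for f
      using A_adj_surjective[OF tf that, of A]
      by (auto simp: J_dom_def J_op_def zero_H1(1)[OF tf] A_op_zero[OF tf])
    show "gradJ x \<in> ?X" if "x \<in> ?X" for x using that by (rule gradJ_in)
    show "\<mu> * (norm (x - y))\<^sup>2 \<le> (gradJ x - gradJ y) \<bullet> (x - y)" if "x \<in> ?X" "y \<in> ?X" for x y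
      using gradJ_bounds[OF that] by simp
    show "norm (gradJ x - gradJ y) \<le> N * norm (x - y)" if xy: "x \<in> ?X" "y \<in> ?X" for x y
    proof -
      \<comment> \<open>The potential is \<open>state_cost tf l\<close>, and strong monotonicity
        supplies its convexity.\<close>
      have "norm (gradJ x - gradJ y) \<le> L * norm (x - y)"
      proof (rule convex_gradient_lipschitz[OF subspace_L2_on gradJ_in gradJ L _ _ xy])
        show "0 \<le> (gradJ x - gradJ y) \<bullet> (x - y)" if "x \<in> ?X" "y \<in> ?X" for x y
          using gradJ_bounds[OF that] \<mu> by (meson less_imp_le mult_nonneg_nonneg order_trans zero_le_power2)
      qed (use gradJ_bounds in auto)
      also have "\<dots> \<le> N * norm (x - y)" using N by (intro mult_right_mono) auto
      finally show ?thesis .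
    qed
    show "norm (R2 p - R2 q) \<le> N * norm (p - q)" if "p \<in> ?Z" "q \<in> ?Z" for p q
      using R2_lip[OF that] mult_right_mono[OF N(3), of "norm (p - q)"] by simp
    \<comment> \<open>The optimality system, rearranged, says that \<open>wstar\<close> is an
      equilibrium.\<close>
    show "J_op tf A wstar = (gradJ (fst wstar), R2 (snd wstar)) + (0, (0, x0))"
      using wstar fun_cong[OF R, of wstar] by (simp add: S_op_def algebra_simps diff_eq_eq)
  qed (use R2_in R2_mono \<mu> C N wstar_dom in auto)
  then show ?thesis unfolding W R
    by (elim exE conjE) (intro exI[of _ 2] exI conjI; auto)
qed

end
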